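(* Let $G$ be an $H$-type group with structure matrices $U^{(1)},\dots,U^{(m)}$ and let $\lambda\in\mathbb R^m\setminus\{0\}$. Let $\partial\Omega$ be the boundary of a bounded domain $\Omega$ in $\mathbb C^n$. Let $f$ be such that $f(z)e^{\left(\frac14+\epsilon\right)|\lambda||z|^2}\in L^p(\mathbb C^n)$ for some $\epsilon>0$ and $1\le p\le\infty$. Suppose that $f\times_\lambda\mu_s(z)=0$ for all $z\in\partial\Omega$ and $s>0$. Then $f=0$.
   Context: $U^{(1)},\dots,U^{(m)}$ are real skew-symmetric orthogonal $2n\times2n$ matrices with $U^{(j)}U^{(l)}+U^{(l)}U^{(j)}=0$ for $j\ne l$; the $H$-type group is $\mathbb R^{2n}\times\mathbb R^m$ with law $(x,t)(\xi,\tau)=(x+\xi,(t_j+\tau_j+\frac12\langle x,U^{(j)}\xi\rangle)_j)$. Identify $x=(x_1,\dots,x_n,y_1,\dots,y_n)\in\mathbb R^{2n}$ with its complexification $z=(x_1+iy_1,\dots,x_n+iy_n)\in\mathbb C^n$; $U^{(j)}w$ denotes the complexification of $U^{(j)}\xi$ if $w$ is that of $\xi$, and $z\cdot w=\sum_jz_jw_j$. With $\mu_s$ the normalized surface measure on $\{|w|=s\}\subset\mathbb C^n$, the $\lambda$-twisted spherical mean is $$f\times_\lambda\mu_s(z)=\int_{|w|=s}f(z-w)\,e^{\frac i2\sum_{j=1}^m\lambda_j\mathrm{Re}(z\cdot\overline{U^{(j)}w})}\,d\mu_s(w).$$ *)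

theory Defs
  imports "HOL-Analysis.Analysis" "HOL-Algebra.Group"
begin

text \<open>
  Coordinates of \<open>\<real>\<^sup>2\<^sup>n\<close> are indexed by \<open>'n + 'n\<close> with \<open>n = CARD('n)\<close>: \<open>Inl k\<close> is the coordinate
  \<open>x\<^sub>k\<close> and \<open>Inr k\<close> is the coordinate \<open>y\<^sub>k\<close>.
\<close>

definition complexify :: "real ^ ('n::finite + 'n) \<Rightarrow> complex ^ 'n" where
  "complexify x = (\<chi> k. Complex (x $ Inl k) (x $ Inr k))"

definition realify :: "complex ^ 'n::finite \<Rightarrow> real ^ ('n + 'n)" where
  "realify z = (\<chi> i. case i of Inl k \<Rightarrow> Re (z $ k) | Inr k \<Rightarrow> Im (z $ k))"

lemma complexify_realify: "complexify (realify z) = z"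
  by (simp add: complexify_def realify_def vec_eq_iff)

lemma realify_complexify: "realify (complexify x) = x"
  by (auto simp: complexify_def realify_def vec_eq_iff split: sum.split)

definition h_type_matrices :: "('m::finite \<Rightarrow> real ^ ('n::finite + 'n) ^ ('n + 'n)) \<Rightarrow> bool" where
  "h_type_matrices U \<longleftrightarrow>
     (\<forall>j. transpose (U j) = - U j \<and> orthogonal_matrix (U j)) \<and>
     (\<forall>j l. j \<noteq> l \<longrightarrow> U j ** U l + U l ** U j = 0)"

definition h_type_group ::
  "('m::finite \<Rightarrow> real ^ ('n::finite + 'n) ^ ('n + 'n)) \<Rightarrow> ((real ^ ('n + 'n)) \<times> (real ^ 'm)) monoid" where
  "h_type_group U =
     \<lparr>carrier = UNIV,
      mult = (\<lambda>(x, t) (\<xi>, \<tau>). (x + \<xi>, \<chi> j. t $ j + \<tau> $ j + (1/2) * (x \<bullet> (U j *v \<xi>)))),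
      one = (0, 0)\<rparr>"

definition is_h_type_group ::
  "((real ^ ('n::finite + 'n)) \<times> (real ^ 'm)) monoid \<Rightarrow>
   ('m::finite \<Rightarrow> real ^ ('n + 'n) ^ ('n + 'n)) \<Rightarrow> bool" where
  "is_h_type_group G U \<longleftrightarrow> h_type_matrices U \<and> G = h_type_group U"

lemma inner_skew:
  fixes A :: "real ^ 'k::finite ^ 'k"
  assumes "transpose A = - A"
  shows "x \<bullet> (A *v x) = 0"
proof -
  have neg: "(- A) *v x = - (A *v x)"
    by (simp add: matrix_vector_mult_def vec_eq_iff sum_negf)
  have "x \<bullet> (A *v x) = (transpose A *v x) \<bullet> x"
    by (simp add: dot_lmul_matrix)
  also have "\<dots> = - (x \<bullet> (A *v x))"
    unfolding assms neg by (simp add: inner_commute)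
  finally show ?thesis by simp
qed

lemma group_h_type_group:
  assumes "is_h_type_group G U"
  shows "group G"
proof -
  have sk: "x \<bullet> (U j *v x) = 0" for j x
    using assms inner_skew unfolding is_h_type_group_def h_type_matrices_def by blast
  have G: "G = h_type_group U" using assms by (simp add: is_h_type_group_def)
  show ?thesis
  proof (rule groupI)
    fix p assume "p \<in> carrier G"
    show "\<exists>q\<in>carrier G. q \<otimes>\<^bsub>G\<^esub> p = \<one>\<^bsub>G\<^esub>"
      by (rule bexI[of _ "(- fst p, - snd p)"])
        (auto simp: G h_type_group_def split_beta vec_eq_iff sk)
  qed (auto simp: G h_type_group_def split_beta vec_eq_iff inner_add_left inner_add_right
      matrix_vector_right_distrib algebra_simps add_divide_distrib)
qed

text \<open>
  The normalized surface measure on the sphere of radius \<open>s\<close> around \<open>0\<close>, realised as the image of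
  the normalized volume of the unit ball under radial projection: the surface measure of a subset
  of the unit sphere is the dimension times the volume of the cone over it. The measure is
  completed because \<open>f\<close> is only Lebesgue measurable below: its restrictions to spheres need not be
  Borel, and Bochner integrals of non-measurable functions are \<open>0\<close> by convention.
\<close>

definition sphere_measure :: "real \<Rightarrow> 'a::euclidean_space measure" where
  "sphere_measure s =
     completion (distr (uniform_measure lborel (ball 0 1)) borel (\<lambda>w. (s / norm w) *\<^sub>R w))"

lemma
  shows emeasure_space_sphere_measure:
      "emeasure (sphere_measure s) (space (sphere_measure s :: 'a::euclidean_space measure)) = 1"
    and AE_sphere_measure: "s > 0 \<Longrightarrow> AE w in (sphere_measure s :: 'a measure). w \<in> sphere 0 s"
proof -
  let ?B = "uniform_measure lborel (ball (0::'a) 1)"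
  let ?r = "\<lambda>w::'a. (s / norm w) *\<^sub>R w"
  have r: "?r \<in> ?B \<rightarrow>\<^sub>M borel"
    by (subst measurable_cong_sets[OF sets_uniform_measure refl]) measurable
  have "emeasure lborel (ball (0::'a) 1) \<noteq> 0"
    using open_not_negligible[of "ball (0::'a) 1"]
    by (auto simp: negligible_iff_null_sets null_sets_def)
  then have "emeasure ?B (space ?B) = 1"
    using emeasure_lborel_ball_finite[of "0::'a" 1] by (simp add: divide_eq_1_ennreal)
  then show "emeasure (sphere_measure s) (space (sphere_measure s :: 'a measure)) = 1"
    unfolding sphere_measure_def using r by (simp add: emeasure_distr)
  assume s: "s > 0"
  have "AE w in lborel. w \<in> ball (0::'a) 1 \<longrightarrow> ?r w \<in> sphere 0 s"
    by (rule AE_mp[OF AE_lborel_singleton[of "0::'a"]]) (use s in auto)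
  then have "AE w in ?B. ?r w \<in> sphere 0 s"
    by (intro AE_uniform_measureI) auto
  then have "AE w in distr ?B borel ?r. w \<in> sphere 0 s"
    using r by (subst AE_distr_iff) auto
  then show "AE w in (sphere_measure s :: 'a measure). w \<in> sphere 0 s"
    unfolding sphere_measure_def by (rule AE_completion)
qed

definition in_Lp :: "ennreal \<Rightarrow> ('a::euclidean_space \<Rightarrow> complex) \<Rightarrow> bool" where
  "in_Lp p g \<longleftrightarrow> g \<in> borel_measurable lebesgue \<and>
     (if p = \<infinity> then \<exists>C. AE x in lebesgue. norm (g x) \<le> C
      else integrable lebesgue (\<lambda>x. norm (g x) powr enn2real p))"

definition cdot :: "complex ^ 'n::finite \<Rightarrow> complex ^ 'n \<Rightarrow> complex" where
  "cdot z w = (\<Sum>k\<in>UNIV. z $ k * w $ k)"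

definition cnj_vec :: "complex ^ 'n::finite \<Rightarrow> complex ^ 'n" where
  "cnj_vec w = (\<chi> k. cnj (w $ k))"

definition cact :: "real ^ ('n::finite + 'n) ^ ('n + 'n) \<Rightarrow> complex ^ 'n \<Rightarrow> complex ^ 'n" where
  "cact A w = complexify (A *v realify w)"

text \<open>
  For locally integrable \<open>f\<close> and fixed \<open>z\<close>, the integrand below is integrable for almost
  every \<open>s > 0\<close>; at the remaining radii the Bochner integral is \<open>0\<close> by convention.
\<close>

definition twisted_spherical_mean ::
  "('m::finite \<Rightarrow> real ^ ('n::finite + 'n) ^ ('n + 'n)) \<Rightarrow> real ^ 'm \<Rightarrow>
   (complex ^ 'n \<Rightarrow> complex) \<Rightarrow> real \<Rightarrow> complex ^ 'n \<Rightarrow> complex" where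
  "twisted_spherical_mean U lam f s z =
     (LINT w|sphere_measure s.
        f (z - w) * exp (\<i> / 2 * of_real (\<Sum>j\<in>UNIV. lam $ j * Re (cdot z (cnj_vec (cact (U j) w))))))"

end

theory Submission
  imports Defs "HOL-Complex_Analysis.Cauchy_Integral_Formula"
begin

text \<open>
  Write \<open>\<kappa> = norm lam\<close> and let \<open>J w\<close> be the sum of the \<open>lam $ j *\<^sub>R cact (U j) w\<close>. By the relations
  between the structure matrices \<open>J\<close> is skew and \<open>norm (J w) = \<kappa> * norm w\<close>, and the phase of the twisted mean is half of
  \<open>z \<bullet> J w\<close>.

  If all spherical means at \<open>z\<close> vanish then so does every radial average of the same integrand. Gaussian
  weights give, after \<open>w\<close> is replaced by \<open>z - w\<close>,
  \<open>T\<^sub>b(z) = 0\<close> for \<open>z\<close> in the boundary of \<open>\<Omega>\<close> and \<open>b \<ge> -\<kappa>/4\<close>, where \<open>T\<^sub>b(z)\<close> (\<open>gmean b z\<close> below) is the integral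
  of \<open>f(w) e\<^bsup>-(\<i>/2) (z \<bullet> J w) - b (norm (z - w))\<^sup>2\<^esup>\<close> over \<open>w\<close>. Negative \<open>b\<close> is where the growth condition on \<open>f\<close> is spent: \<open>T\<^sub>b\<close> is finite, and bounded for bounded
  \<open>z\<close>, down to \<open>b = -\<kappa>/4\<close>.

  Let \<open>d\<close> be the real dimension of the space. The substitution \<open>b = (\<kappa>/4) tanh s\<close> turns the family into a solution of a heat equation: with
  \<open>D = \<nabla> + (\<i>/2) J z\<close> the function \<open>u(s, z) = (cosh s)\<^bsup>-d/2\<^esup> T\<^sub>b(z)\<close> satisfies
  \<open>\<kappa> \<partial>\<^sub>s u = D \<cdot> D u\<close>, for all real times \<open>s\<close>. It tends to \<open>0\<close> as \<open>s\<close> tends to \<open>-\<infinity>\<close>, because \<open>T\<^sub>b\<close> stays bounded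
  while the prefactor decays, and it vanishes on the boundary of \<open>\<Omega>\<close>. A solution of the magnetic heat equation
  with zero boundary values has nonincreasing supremum on \<open>\<Omega>\<close> (the maximum principle for \<open>\<bar>u\<bar>\<close>, which holds
  because the phase can be gauged away at the maximum point). Hence \<open>u = 0\<close> on \<open>\<Omega>\<close>; this is
  \<open>gmean_zero_inside\<close>.

  The rest is analytic continuation. \<open>T\<^sub>b(z)\<close> is analytic in \<open>b\<close>, so for \<open>z\<close> in \<open>\<Omega>\<close> it vanishes for all
  larger \<open>b\<close> (\<open>gmean_zero_later\<close>), and it is analytic along lines in \<open>z\<close>, so it vanishes for all \<open>z\<close>
  (\<open>gmean_zero_everywhere\<close>). For large \<open>b\<close> the kernel, suitably normalised, is an approximate identity, which recovers \<open>f\<close>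
  and gives \<open>f = 0\<close> (\<open>AE_zero_of_gmean_zero\<close>).
\<close>

section \<open>Integrals of exponential families\<close>

lemma quadratic_absorb:
  fixes A B C c :: real
  assumes "A < c"
  shows "\<exists>K. \<forall>x. A * x\<^sup>2 + B * x + C \<le> c * x\<^sup>2 + K"
proof (intro exI allI)
  fix x :: real
  have "0 \<le> (2 * (c - A) * x - B)\<^sup>2 / (4 * (c - A))"
    using assms by simp
  also have "\<dots> = (c - A) * x\<^sup>2 - B * x + B\<^sup>2 / (4 * (c - A))"
    using assms by (simp add: field_simps power2_eq_square)
  finally show "A * x\<^sup>2 + B * x + C \<le> c * x\<^sup>2 + (C + B\<^sup>2 / (4 * (c - A)))"
    by (simp add: algebra_simps)
qed

lemma norm_exp_minus_1_le: "norm (exp z - 1) \<le> norm z * exp (norm z)" for z :: complex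
proof -
  have "norm (exp z - 1) \<le> exp \<bar>Re z\<bar> * norm z"
    using Taylor_exp[of z 0] by simp
  also have "\<dots> \<le> exp (norm z) * norm z"
    by (intro mult_right_mono) (auto simp: abs_Re_le_cmod)
  finally show ?thesis by (simp add: mult.commute)
qed

lemma exp_second_difference_eq:
  "exp z + exp (- z) - 2 = (exp (z/2) - exp (- z/2))\<^sup>2" for z :: complex
proof -
  have "exp z = exp (z/2) * exp (z/2)" "exp (-z) = exp (-z/2) * exp (-z/2)"
      "exp (z/2) * exp (-z/2) = 1"
    by (simp_all flip: exp_add)
  then show ?thesis by (simp add: power2_eq_square algebra_simps)
qed

lemma norm_exp_second_difference_le:
  "norm (exp z + exp (- z) - 2) \<le> (norm z)\<^sup>2 * exp (norm z)" for z :: complex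
proof -
  have "norm (exp (z/2) - exp (- z/2)) \<le> norm (exp (z/2) - 1) + norm (exp (- z/2) - 1)"
    using norm_triangle_ineq4[of "exp (z/2) - 1" "exp (- z/2) - 1"] by simp
  also have "\<dots> \<le> norm z * exp (norm z / 2)"
    using norm_exp_minus_1_le[of "z/2"] norm_exp_minus_1_le[of "-z/2"] by (simp add: norm_divide)
  finally have "(norm (exp (z/2) - exp (- z/2)))\<^sup>2 \<le> (norm z * exp (norm z / 2))\<^sup>2"
    by (intro power_mono) auto
  also have "\<dots> = (norm z)\<^sup>2 * exp (norm z)"
    by (simp add: power_mult_distrib flip: exp_of_nat_mult)
  finally show ?thesis unfolding exp_second_difference_eq norm_power .
qed

lemma LIMSEQ_divide_Suc: "(\<lambda>k. a / real (Suc k)) \<longlonglongrightarrow> 0"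
  by real_asymp

lemma divide_Suc_le: "0 \<le> a \<Longrightarrow> a / real (Suc k) \<le> (a::real)"
  by (simp add: divide_le_eq mult_le_cancel_left1)

lemma filterlim_of_real_at_0:
  assumes "\<And>k. 0 < t k" "t \<longlonglongrightarrow> 0"
  shows "filterlim (\<lambda>k. complex_of_real (t k)) (at 0) sequentially"
proof -
  have "(\<lambda>k. complex_of_real (t k)) \<longlonglongrightarrow> of_real 0"
    using assms(2) by (rule tendsto_of_real)
  moreover have "t k \<noteq> 0" for k using assms(1)[of k] by simp
  ultimately show ?thesis unfolding filterlim_at by simp
qed

text \<open>
  The Gaussian means are integrals of the form \<open>\<integral> g e\<^bsup>t h\<^esup>\<close>, as functions of the shift \<open>t\<close> of the time parameter
  or of the centre. A single exponential majorant makes them analytic for \<open>norm t \<le> R\<close> and allows differentiation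
  under the integral at \<open>t = 0\<close>.
\<close>

context
  fixes M :: "'b measure" and g h :: "'b \<Rightarrow> complex" and R :: real
  assumes g [measurable]: "g \<in> borel_measurable M" and h [measurable]: "h \<in> borel_measurable M"
    and R: "R > 0" and int: "integrable M (\<lambda>w. norm (g w) * exp (R * norm (h w)))"
begin

lemma integrable_exp_family: "integrable M (\<lambda>w. g w * exp (t * h w))" if "norm t \<le> R" for t :: complex
proof (rule Bochner_Integration.integrable_bound[OF int])
  show "AE w in M. norm (g w * exp (t * h w)) \<le> norm (norm (g w) * exp (R * norm (h w)))"
  proof (intro AE_I2)
    fix w
    have "norm (exp (t * h w)) \<le> exp (norm (t * h w))" by (rule norm_exp)
    also have "\<dots> \<le> exp (R * norm (h w))"
      using that by (simp add: norm_mult mult_right_mono)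
    finally show "norm (g w * exp (t * h w)) \<le> norm (norm (g w) * exp (R * norm (h w)))"
      by (simp add: norm_mult mult_left_mono)
  qed
qed simp

lemma integrable_exp_family_0: "integrable M g"
  using integrable_exp_family[of 0] R by simp

lemma integrable_exp_moment: "integrable M (\<lambda>w. g w * h w ^ k)"
proof (rule Bochner_Integration.integrable_bound)
  show "integrable M (\<lambda>w. (fact k / R ^ k) * (norm (g w) * exp (R * norm (h w))))"
    using int by simp
  have le: "x ^ k \<le> fact k * exp x" if "x \<ge> 0" for x :: real
  proof -
    have "(\<Sum>n\<in>{k}. x ^ n /\<^sub>R fact n) \<le> exp x"
      unfolding exp_def by (intro sum_le_suminf summable_exp_generic) (use that in auto)
    then show ?thesis by (simp add: field_simps)
  qed
  show "AE w in M. norm (g w * h w ^ k) \<le> norm (fact k / R ^ k * (norm (g w) * exp (R * norm (h w))))"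
  proof (intro AE_I2)
    fix w
    have "(R * norm (h w)) ^ k \<le> fact k * exp (R * norm (h w))" using R by (intro le) auto
    then have "norm (h w) ^ k \<le> fact k / R ^ k * exp (R * norm (h w))"
      using R by (simp add: power_mult_distrib field_simps)
    then have "norm (g w) * norm (h w) ^ k \<le> norm (g w) * (fact k / R ^ k * exp (R * norm (h w)))"
      by (rule mult_left_mono) simp
    then show "norm (g w * h w ^ k) \<le> norm (fact k / R ^ k * (norm (g w) * exp (R * norm (h w))))"
      using R by (simp add: norm_mult norm_power algebra_simps)
  qed
qed simp

lemma exp_family_sums:
  assumes "norm t \<le> R"
  shows "(\<lambda>k. (LINT w|M. g w * h w ^ k) / fact k * t ^ k) sums (LINT w|M. g w * exp (t * h w))"
  unfolding sums_def
proof -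
  have "(\<lambda>n. LINT w|M. (\<Sum>k<n. g w * (t * h w) ^ k /\<^sub>R fact k)) \<longlonglongrightarrow> (LINT w|M. g w * exp (t * h w))"
  proof (rule integral_dominated_convergence[OF _ _ int])
    show "AE w in M. (\<lambda>n. \<Sum>k<n. g w * (t * h w) ^ k /\<^sub>R fact k) \<longlonglongrightarrow> g w * exp (t * h w)"
    proof (intro AE_I2)
      fix w
      have "(\<lambda>k. g w * ((t * h w) ^ k /\<^sub>R fact k)) sums (g w * exp (t * h w))"
        by (intro sums_mult exp_converges)
      then show "(\<lambda>n. \<Sum>k<n. g w * (t * h w) ^ k /\<^sub>R fact k) \<longlonglongrightarrow> g w * exp (t * h w)"
        by (simp add: sums_def)
    qed
    show "AE w in M. norm (\<Sum>k<n. g w * (t * h w) ^ k /\<^sub>R fact k) \<le> norm (g w) * exp (R * norm (h w))" for n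
    proof (intro AE_I2)
      fix w
      have "norm (\<Sum>k<n. g w * (t * h w) ^ k /\<^sub>R fact k) \<le> (\<Sum>k<n. norm (g w) * ((R * norm (h w)) ^ k /\<^sub>R fact k))"
      proof (rule sum_norm_le)
        fix k
        have "norm (t * h w) ^ k \<le> (R * norm (h w)) ^ k"
          using assms by (intro power_mono) (auto simp: norm_mult mult_right_mono)
        then show "norm (g w * (t * h w) ^ k /\<^sub>R fact k) \<le> norm (g w) * ((R * norm (h w)) ^ k /\<^sub>R fact k)"
          unfolding norm_scaleR norm_mult norm_power
          by (simp add: norm_mult norm_power mult_left_mono divide_right_mono divide_inverse mult_ac)
      qed
      also have "\<dots> = norm (g w) * (\<Sum>k<n. (R * norm (h w)) ^ k /\<^sub>R fact k)"
        by (simp add: sum_distrib_left)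
      also have "(\<Sum>k<n. (R * norm (h w)) ^ k /\<^sub>R fact k) \<le> exp (R * norm (h w))"
        unfolding exp_def by (intro sum_le_suminf summable_exp_generic) (use R in auto)
      finally show "norm (\<Sum>k<n. g w * (t * h w) ^ k /\<^sub>R fact k) \<le> norm (g w) * exp (R * norm (h w))"
        by (simp add: mult_left_mono)
    qed
  qed simp_all
  moreover have "(LINT w|M. (\<Sum>k<n. g w * (t * h w) ^ k /\<^sub>R fact k)) =
      (\<Sum>k<n. (LINT w|M. g w * h w ^ k) / fact k * t ^ k)" for n
  proof -
    have eq: "g w * (t * h w) ^ k /\<^sub>R fact k = (g w * h w ^ k) * (t ^ k / fact k)" for w k
      by (simp add: power_mult_distrib scaleR_conv_of_real field_simps)
    have int': "integrable M (\<lambda>w. (g w * h w ^ k) * (t ^ k / fact k))" for k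
      by (intro integrable_mult_left integrable_exp_moment)
    show ?thesis unfolding eq
      by (subst Bochner_Integration.integral_sum) (use int' in \<open>auto intro!: sum.cong integral_mult_left_zero simp flip: mult.assoc times_divide_eq_right\<close>)
  qed
  ultimately show "(\<lambda>n. \<Sum>k<n. (LINT w|M. g w * h w ^ k) / fact k * t ^ k) \<longlonglongrightarrow> (LINT w|M. g w * exp (t * h w))"
    by simp
qed

text \<open>
  By the power series the integral is analytic in \<open>t\<close>, so its zeros are isolated unless it vanishes identically. The zeros
  need only be known on one side of \<open>0\<close>; in the time parameter these are the earlier times.
\<close>

lemma exp_family_continuation:
  assumes "\<delta> > 0" and zero: "\<And>s::real. 0 < s \<Longrightarrow> s < \<delta> \<Longrightarrow> (LINT w|M. g w * exp (of_real s * h w)) = 0"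
    and t: "norm t \<le> R"
  shows "(LINT w|M. g w * exp (t * h w)) = 0"
proof -
  define a where "a k = (LINT w|M. g w * h w ^ k) / fact k" for k
  define F where "F t = (LINT w|M. g w * exp (t * h w))" for t
  have sm: "(\<lambda>k. a k * t ^ k) sums F t" if "norm t \<le> R" for t
    unfolding a_def F_def by (rule exp_family_sums[OF that])
  have "continuous_on (ball 0 R) F"
  proof -
    have "F holomorphic_on ball 0 R"
      by (rule power_series_holomorphic[where a=a]) (use sm in \<open>auto intro: less_imp_le simp: dist_norm\<close>)
    then show ?thesis by (rule holomorphic_on_imp_continuous_on)
  qed
  then have "isCont F 0" using R by (simp add: continuous_on_eq_continuous_at)
  have F0: "F 0 = 0"
  proof -
    define u where "u n = complex_of_real (\<delta> / (real n + 2))" for n :: nat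
    have "(\<lambda>n. \<delta> / (real n + 2)) \<longlonglongrightarrow> 0" by real_asymp
    then have "u \<longlonglongrightarrow> of_real 0" unfolding u_def by (rule tendsto_of_real)
    then have "(\<lambda>n. F (u n)) \<longlonglongrightarrow> F 0"
      using isCont_tendsto_compose[OF \<open>isCont F 0\<close>] by simp
    moreover have "F (u n) = 0" for n
      unfolding F_def u_def using \<open>\<delta> > 0\<close> by (intro zero) (auto simp: field_simps add_pos_nonneg)
    ultimately show ?thesis by (simp add: LIMSEQ_const_iff)
  qed
  have a0: "a 0 = 0" using sm[of 0] F0 R by (metis norm_zero less_imp_le powser_sums_zero_iff)
  have "a m = 0" for m
  proof (rule ccontr)
    assume "a m \<noteq> 0"
    then have "m > 0" using a0 by (cases m) auto
    obtain s where s: "s > 0" "\<And>z. z \<in> cball 0 s - {0} \<Longrightarrow> F z \<noteq> 0"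
      using powser_0_nonzero[of R 0 a F m] R sm F0 \<open>a m \<noteq> 0\<close> \<open>m > 0\<close> by (auto simp: less_imp_le)
    define x where "x = min s (\<delta>/2)"
    have "F (of_real x) \<noteq> 0" using s(1) \<open>\<delta> > 0\<close> by (intro s(2)) (auto simp: x_def)
    moreover have "F (of_real x) = 0" unfolding F_def using s(1) \<open>\<delta> > 0\<close> by (intro zero) (auto simp: x_def)
    ultimately show False by simp
  qed
  then show ?thesis using sm[OF t] sums_unique2[OF sums_zero] unfolding F_def by fastforce
qed

text \<open>
  Comparison with a maximal value gives signs to difference quotients, so the derivatives at \<open>0\<close> are
  computed as limits of difference quotients along a sequence; half of the available exponent \<open>R\<close> pays for the factor
  \<open>norm (h w)\<close> (below, its square) in the majorant.
\<close>

lemma exp_family_first_difference: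
  assumes t: "\<And>k. 0 < t k" "\<And>k. t k \<le> R / 2" "t \<longlonglongrightarrow> 0"
  shows "(\<lambda>k. ((LINT w|M. g w * exp (of_real (t k) * h w)) - (LINT w|M. g w)) / of_real (t k))
    \<longlonglongrightarrow> (LINT w|M. g w * h w)"
proof -
  have tR: "t k \<le> R" for k using t(1,2)[of k] R by simp
  have "(\<lambda>k. LINT w|M. g w * ((exp (of_real (t k) * h w) - 1) / of_real (t k))) \<longlonglongrightarrow> (LINT w|M. g w * h w)"
  proof (rule integral_dominated_convergence)
    show "integrable M (\<lambda>w. (2 / R) * (norm (g w) * exp (R * norm (h w))))" using int by simp
    show "AE w in M. (\<lambda>k. g w * ((exp (of_real (t k) * h w) - 1) / of_real (t k))) \<longlonglongrightarrow> g w * h w"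
    proof (intro AE_I2 tendsto_mult tendsto_const)
      fix w
      have "((\<lambda>s. exp (s * h w)) has_field_derivative h w) (at 0)"
        by (auto intro!: derivative_eq_intros)
      then have "(\<lambda>s. (exp (s * h w) - 1) / s) \<midarrow>0\<rightarrow> h w"
        by (simp add: DERIV_def)
      moreover have "filterlim (\<lambda>k. complex_of_real (t k)) (at 0) sequentially"
        by (rule filterlim_of_real_at_0) (use t in auto)
      ultimately show "(\<lambda>k. (exp (of_real (t k) * h w) - 1) / of_real (t k)) \<longlonglongrightarrow> h w"
        by (rule filterlim_compose)
    qed
    show "AE w in M. norm (g w * ((exp (of_real (t k) * h w) - 1) / of_real (t k))) \<le> (2 / R) * (norm (g w) * exp (R * norm (h w)))" for k
    proof (intro AE_I2)
      fix w
      let ?x = "norm (h w)"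
      have "norm (exp (of_real (t k) * h w) - 1) \<le> (t k * ?x) * exp (t k * ?x)"
        using norm_exp_minus_1_le[of "of_real (t k) * h w"] t(1)[of k] by (simp add: norm_mult)
      then have "norm ((exp (of_real (t k) * h w) - 1) / of_real (t k)) \<le> ?x * exp (t k * ?x)"
        using t(1)[of k] by (simp add: norm_divide field_simps)
      also have "\<dots> \<le> (2 / R * exp (R / 2 * ?x)) * exp (R / 2 * ?x)"
      proof (intro mult_mono)
        have "R / 2 * ?x \<le> exp (R / 2 * ?x)" using exp_ge_add_one_self[of "R / 2 * ?x"] by linarith
        then show "?x \<le> 2 / R * exp (R / 2 * ?x)" using R by (simp add: field_simps)
        show "exp (t k * ?x) \<le> exp (R / 2 * ?x)" using t(2)[of k] by (simp add: mult_right_mono del: times_divide_eq_left)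
      qed (use R in auto)
      also have "\<dots> = 2 / R * exp (R * ?x)" by (simp flip: exp_add)
      finally have "norm (g w) * norm ((exp (of_real (t k) * h w) - 1) / of_real (t k)) \<le> norm (g w) * (2 / R * exp (R * ?x))"
        by (rule mult_left_mono) simp
      then show "norm (g w * ((exp (of_real (t k) * h w) - 1) / of_real (t k))) \<le> (2 / R) * (norm (g w) * exp (R * ?x))"
        unfolding norm_mult by (simp add: mult.left_commute)
    qed
  qed simp_all
  moreover have "(LINT w|M. g w * ((exp (of_real (t k) * h w) - 1) / of_real (t k))) =
     ((LINT w|M. g w * exp (of_real (t k) * h w)) - (LINT w|M. g w)) / of_real (t k)" for k
  proof -
    have "integrable M (\<lambda>w. g w * exp (of_real (t k) * h w))"
      using tR[of k] t(1)[of k] by (intro integrable_exp_family) auto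
    then show ?thesis using integrable_exp_family_0
      by (simp add: algebra_simps flip: Bochner_Integration.integral_diff)
  qed
  ultimately show ?thesis by (simp only:)
qed

lemma exp_family_second_difference:
  assumes t: "\<And>k. 0 < t k" "\<And>k. t k \<le> R / 2" "t \<longlonglongrightarrow> 0"
  shows "(\<lambda>k. ((LINT w|M. g w * exp (of_real (t k) * h w)) + (LINT w|M. g w * exp (- of_real (t k) * h w))
      - 2 * (LINT w|M. g w)) / of_real ((t k)\<^sup>2)) \<longlonglongrightarrow> (LINT w|M. g w * (h w)\<^sup>2)"
proof -
  define D where "D k w = (exp (of_real (t k) * h w) + exp (- of_real (t k) * h w) - 2) / of_real ((t k)\<^sup>2)" for k w
  have [measurable]: "D k \<in> borel_measurable M" for k unfolding D_def by measurable
  have tR: "t k \<le> R" for k using t(1,2)[of k] R by simp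
  have "(\<lambda>k. LINT w|M. g w * D k w) \<longlonglongrightarrow> (LINT w|M. g w * (h w)\<^sup>2)"
  proof (rule integral_dominated_convergence)
    show "integrable M (\<lambda>w. (8 / R\<^sup>2) * (norm (g w) * exp (R * norm (h w))))" using int by simp
    show "AE w in M. (\<lambda>k. g w * D k w) \<longlonglongrightarrow> g w * (h w)\<^sup>2"
    proof (intro AE_I2 tendsto_mult tendsto_const)
      fix w
      have "((\<lambda>s. exp (s * (h w / 2)) - exp (- s * (h w / 2))) has_field_derivative h w) (at 0)"
        by (auto intro!: derivative_eq_intros)
      then have "(\<lambda>s. (exp (s * (h w / 2)) - exp (- s * (h w / 2))) / s) \<midarrow>0\<rightarrow> h w"
        by (simp add: DERIV_def)
      moreover have "filterlim (\<lambda>k. complex_of_real (t k)) (at 0) sequentially"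
        by (rule filterlim_of_real_at_0) (use t in auto)
      ultimately have "(\<lambda>k. (exp (of_real (t k) * (h w / 2)) - exp (- of_real (t k) * (h w / 2))) / of_real (t k)) \<longlonglongrightarrow> h w"
        by (rule filterlim_compose)
      then have "(\<lambda>k. ((exp (of_real (t k) * (h w / 2)) - exp (- of_real (t k) * (h w / 2))) / of_real (t k))\<^sup>2) \<longlonglongrightarrow> (h w)\<^sup>2"
        by (intro tendsto_intros)
      moreover have "((exp (of_real (t k) * (h w / 2)) - exp (- of_real (t k) * (h w / 2))) / of_real (t k))\<^sup>2 = D k w" for k
        unfolding D_def using exp_second_difference_eq[of "of_real (t k) * h w"]
        by (simp add: power_divide)
      ultimately show "(\<lambda>k. D k w) \<longlonglongrightarrow> (h w)\<^sup>2" by simp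
    qed
    show "AE w in M. norm (g w * D k w) \<le> (8 / R\<^sup>2) * (norm (g w) * exp (R * norm (h w)))" for k
    proof (intro AE_I2)
      fix w
      let ?x = "norm (h w)"
      have "norm (exp (of_real (t k) * h w) + exp (- of_real (t k) * h w) - 2) \<le> (t k * ?x)\<^sup>2 * exp (t k * ?x)"
        using norm_exp_second_difference_le[of "of_real (t k) * h w"] t(1)[of k] by (simp add: norm_mult)
      then have "norm (D k w) \<le> ?x\<^sup>2 * exp (t k * ?x)"
        unfolding D_def using t(1)[of k] by (simp add: norm_divide norm_power field_simps)
      also have "\<dots> \<le> (8 / R\<^sup>2 * exp (R / 2 * ?x)) * exp (R / 2 * ?x)"
      proof (intro mult_mono)
        have "(R / 2 * ?x)\<^sup>2 / 2 \<le> exp (R / 2 * ?x)" 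
        proof -
          have "0 \<le> R / 2 * ?x" using R by simp
          then show ?thesis using exp_lower_Taylor_quadratic[of "R / 2 * ?x"] by linarith
        qed
        then show "?x\<^sup>2 \<le> 8 / R\<^sup>2 * exp (R / 2 * ?x)" using R by (simp add: field_simps power2_eq_square)
        show "exp (t k * ?x) \<le> exp (R / 2 * ?x)" using t(2)[of k] by (simp add: mult_right_mono del: times_divide_eq_left)
      qed (use R in auto)
      also have "\<dots> = 8 / R\<^sup>2 * exp (R * ?x)" by (simp flip: exp_add)
      finally have "norm (g w) * norm (D k w) \<le> norm (g w) * (8 / R\<^sup>2 * exp (R * ?x))"
        by (rule mult_left_mono) simp
      then show "norm (g w * D k w) \<le> (8 / R\<^sup>2) * (norm (g w) * exp (R * ?x))"
        unfolding norm_mult by (simp add: mult.left_commute)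
    qed
  qed simp_all
  moreover have "(LINT w|M. g w * D k w) =
     ((LINT w|M. g w * exp (of_real (t k) * h w)) + (LINT w|M. g w * exp (- of_real (t k) * h w))
      - 2 * (LINT w|M. g w)) / of_real ((t k)\<^sup>2)" for k
  proof -
    have 1: "integrable M (\<lambda>w. g w * exp (of_real (t k) * h w))" "integrable M (\<lambda>w. g w * exp (- of_real (t k) * h w))"
      using tR[of k] t(1)[of k] by (intro integrable_exp_family; simp)+
    have "(LINT w|M. g w * D k w) = (LINT w|M. (g w * exp (of_real (t k) * h w) + g w * exp (- of_real (t k) * h w) - g w * 2) / of_real ((t k)\<^sup>2))"
      unfolding D_def by (simp only: times_divide_eq_right distrib_left right_diff_distrib)
    also have "\<dots> = ((LINT w|M. g w * exp (of_real (t k) * h w)) + (LINT w|M. g w * exp (- of_real (t k) * h w))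
      - 2 * (LINT w|M. g w)) / of_real ((t k)\<^sup>2)"
      using 1 integrable_exp_family_0 by simp
    finally show ?thesis .
  qed
  ultimately show ?thesis by simp
qed

end

section \<open>Integrability under Gaussian weights\<close>

lemma pred_ball [measurable]: "Measurable.pred borel (\<lambda>w. w \<in> ball (c::'a::euclidean_space) r)"
  unfolding mem_ball by measurable

text \<open>
  On the shell \<open>k \<le> norm x < k + 1\<close> the Gaussian is at most a multiple of \<open>e\<^bsup>-k\<^esup> / (k + 1)\<^sup>d\<close>, and the denominator
  is the volume of the ball of radius \<open>k + 1\<close> up to a constant, so the shells contribute a geometric series.
\<close>

lemma integrable_gaussian:
  assumes "\<delta> > 0"
  shows "integrable lborel (\<lambda>x::'a::euclidean_space. exp (- \<delta> * (norm x)\<^sup>2))"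
proof (rule integrableI_bounded)
  let ?d = "DIM('a)"
  obtain K where K: "- \<delta> * x\<^sup>2 + 2 * x + 1 \<le> 0 * x\<^sup>2 + K" for x :: real
    using quadratic_absorb[of "- \<delta>" 0 2 1] assms by auto
  define C where "C = fact ?d * exp K"
  have bound: "exp (- \<delta> * x\<^sup>2) \<le> C * exp (- real k) / (real k + 1) ^ ?d" if "real k \<le> x" for x k
  proof -
    have "(real k + 1) ^ ?d / fact ?d \<le> exp (real k + 1)"
      using sum_le_suminf[OF summable_exp_generic[of "real k + 1"], of "{?d}"]
      by (simp add: exp_def field_simps)
    then have "(real k + 1) ^ ?d \<le> fact ?d * exp (real k + 1)" by (simp add: field_simps)
    moreover have "exp (- \<delta> * x\<^sup>2) \<le> exp (K - 2 * real k - 1)"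
    proof -
      have "(real k)\<^sup>2 \<le> x\<^sup>2" using that by (intro power_mono) auto
      then have "- \<delta> * x\<^sup>2 \<le> - \<delta> * (real k)\<^sup>2" using assms by simp
      then show ?thesis using K[of "real k"] by simp
    qed
    ultimately have "exp (- \<delta> * x\<^sup>2) * (real k + 1) ^ ?d \<le> exp (K - 2 * real k - 1) * (fact ?d * exp (real k + 1))"
      by (intro mult_mono) auto
    also have "\<dots> = C * exp (- real k)"
      unfolding C_def by (simp add: mult_ac flip: exp_add)
    finally show ?thesis by (simp add: field_simps)
  qed
  let ?u = "\<lambda>k (x::'a). ennreal (C * exp (- real k) / (real k + 1) ^ ?d) * indicator (ball 0 (real k + 1)) x"
  have "(\<integral>\<^sup>+x. ennreal (norm (exp (- \<delta> * (norm (x::'a))\<^sup>2))) \<partial>lborel) \<le> (\<integral>\<^sup>+x. (\<Sum>k. ?u k x) \<partial>lborel)"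
  proof (rule nn_integral_mono)
    fix x :: 'a
    define k where "k = nat \<lfloor>norm x\<rfloor>"
    have k: "real k \<le> norm x" "norm x < real k + 1" unfolding k_def by (auto simp: of_nat_nat; linarith)+
    define u where "u j = ?u j x" for j
    have "ennreal (norm (exp (- \<delta> * (norm x)\<^sup>2))) \<le> u k"
      using k bound[OF k(1)] by (auto simp: u_def intro!: ennreal_leI)
    also have "\<dots> \<le> (\<Sum>k. u k)"
      using sum_le_suminf[of u "{k}"] by simp
    also have "u = (\<lambda>k. ?u k x)" by (simp add: u_def fun_eq_iff)
    finally show "ennreal (norm (exp (- \<delta> * (norm x)\<^sup>2))) \<le> (\<Sum>k. ?u k x)" .
  qed
  also have "\<dots> = (\<Sum>k. \<integral>\<^sup>+x. ?u k x \<partial>lborel)"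
    by (rule nn_integral_suminf) measurable
  also have "\<dots> = (\<Sum>k. ennreal (C * unit_ball_vol ?d * exp (- 1) ^ k))"
  proof (intro suminf_cong)
    fix k
    have "(\<integral>\<^sup>+x. ?u k x \<partial>lborel) = ennreal (C * exp (- real k) / (real k + 1) ^ ?d) * ennreal (unit_ball_vol ?d * (real k + 1) ^ ?d)"
      by (simp add: nn_integral_cmult emeasure_ball)
    also have "\<dots> = ennreal ((C * exp (- real k) / (real k + 1) ^ ?d) * (unit_ball_vol ?d * (real k + 1) ^ ?d))"
      by (rule ennreal_mult[symmetric]) (auto simp: C_def)
    also have "(C * exp (- real k) / (real k + 1) ^ ?d) * (unit_ball_vol ?d * (real k + 1) ^ ?d) = C * unit_ball_vol ?d * exp (- 1) ^ k"
      by (simp add: exp_of_nat_mult[symmetric] add_nonneg_eq_0_iff)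
    finally show "(\<integral>\<^sup>+x. ?u k x \<partial>lborel) = ennreal (C * unit_ball_vol ?d * exp (- 1) ^ k)" .
  qed
  also have "\<dots> = ennreal (\<Sum>k. C * unit_ball_vol ?d * exp (- 1) ^ k)"
    by (intro suminf_ennreal2 summable_mult summable_geometric) (auto simp: C_def)
  also have "\<dots> < \<infinity>" by simp
  finally show "(\<integral>\<^sup>+x. ennreal (norm (exp (- \<delta> * (norm (x::'a))\<^sup>2))) \<partial>lborel) < \<infinity>" .
qed simp

lemma measurable_of_in_Lp_weighted:
  assumes "in_Lp p (\<lambda>z::'a::euclidean_space. f z * of_real (exp (C * (norm z)\<^sup>2)))"
  shows "f \<in> borel_measurable lebesgue"
proof -
  have "(\<lambda>z. (f z * of_real (exp (C * (norm z)\<^sup>2))) * of_real (exp (- C * (norm z)\<^sup>2))) \<in> borel_measurable lebesgue"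
  proof (rule borel_measurable_times)
    show "(\<lambda>z. f z * of_real (exp (C * (norm z)\<^sup>2))) \<in> borel_measurable lebesgue"
      using assms unfolding in_Lp_def by (rule conjunct1)
    show "(\<lambda>z::'a. complex_of_real (exp (- C * (norm z)\<^sup>2))) \<in> borel_measurable lebesgue"
      by (intro measurable_completion) simp
  qed
  also have "(\<lambda>z. (f z * of_real (exp (C * (norm z)\<^sup>2))) * of_real (exp (- C * (norm z)\<^sup>2))) = f"
    by (auto simp: mult.assoc simp flip: of_real_mult exp_add)
  finally show ?thesis .
qed

text \<open>
  Any loss in the exponent turns the weighted \<open>L\<^sup>p\<close> condition into a weighted \<open>L\<^sup>1\<close> condition. Instead of Hoelder's
  inequality, \<open>G * E \<le> G\<^sup>q + E\<close> suffices when \<open>0 \<le> E \<le> 1\<close>: compare with \<open>E\<close> where \<open>G \<le> 1\<close> and with \<open>G\<^sup>q\<close> where \<open>G > 1\<close>.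
\<close>

lemma integrable_of_in_Lp_weighted:
  assumes L: "in_Lp p (\<lambda>z::'a::euclidean_space. f z * of_real (exp (C * (norm z)\<^sup>2)))"
    and p: "1 \<le> p" and "c < C"
  shows "integrable lebesgue (\<lambda>z. norm (f z) * exp (c * (norm z)\<^sup>2))"
proof -
  have f [measurable]: "f \<in> borel_measurable lebesgue" by (rule measurable_of_in_Lp_weighted[OF L])
  have [measurable]: "(\<lambda>z::'a. exp (c * (norm z)\<^sup>2)) \<in> borel_measurable lebesgue"
    by (intro measurable_completion) simp
  let ?G = "\<lambda>z. norm (f z) * exp (C * (norm z)\<^sup>2)"
  let ?E = "\<lambda>z::'a. exp (- (C - c) * (norm z)\<^sup>2)"
  have eq: "norm (f z) * exp (c * (norm z)\<^sup>2) = ?G z * ?E z" for z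
    by (simp add: mult.assoc algebra_simps flip: exp_add)
  have E: "integrable lebesgue ?E"
    using integrable_gaussian[of "C - c"] \<open>c < C\<close> by (subst integrable_completion) auto
  show ?thesis
  proof (cases "p = \<infinity>")
    case True
    then obtain B where B: "AE z in lebesgue. ?G z \<le> B"
      using L by (auto simp: in_Lp_def norm_mult)
    show ?thesis
    proof (rule Bochner_Integration.integrable_bound)
      show "integrable lebesgue (\<lambda>z. B * ?E z)" using E by simp
      show "AE z in lebesgue. norm (norm (f z) * exp (c * (norm z)\<^sup>2)) \<le> norm (B * ?E z)"
        using B
      proof eventually_elim
        case (elim z)
        then have "?G z * ?E z \<le> \<bar>B\<bar> * ?E z" by (intro mult_right_mono) auto
        then show ?case unfolding eq by (simp add: abs_mult)
      qed
    qed simp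
  next
    case False
    define q where "q = enn2real p"
    have q: "q \<ge> 1" using p False unfolding q_def
      by (cases p) (auto simp: top_unique)
    have "integrable lebesgue (\<lambda>z. ?G z powr q)"
      using L False by (auto simp: in_Lp_def norm_mult q_def)
    then have int: "integrable lebesgue (\<lambda>z. ?G z powr q + ?E z)" using E by simp
    show ?thesis
    proof (rule Bochner_Integration.integrable_bound[OF int])
      show "AE z in lebesgue. norm (norm (f z) * exp (c * (norm z)\<^sup>2)) \<le> norm (?G z powr q + ?E z)"
      proof (rule AE_I2)
        fix z
        have "?G z * ?E z \<le> ?G z powr q + ?E z"
        proof (cases "?G z \<le> 1")
          case True
          then have "?G z * ?E z \<le> 1 * ?E z" by (intro mult_right_mono) auto
          then show ?thesis by (smt (verit) powr_ge_zero)
        next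
          case False
          have "?G z * ?E z \<le> ?G z * 1" using \<open>c < C\<close> by (intro mult_left_mono) (auto simp: mult_nonpos_nonneg)
          also have "\<dots> = ?G z powr 1" using False by simp
          also have "\<dots> \<le> ?G z powr q" using q False by (intro powr_mono) auto
          finally show ?thesis by (smt (verit) exp_gt_zero)
        qed
        then show "norm (norm (f z) * exp (c * (norm z)\<^sup>2)) \<le> norm (?G z powr q + ?E z)"
          unfolding eq by simp
      qed
    qed simp
  qed
qed

lemma lebesgue_measurable_borel_representative:
  fixes f :: "'a::euclidean_space \<Rightarrow> complex"
  assumes [measurable]: "f \<in> borel_measurable lebesgue"
  obtains f' where "f' \<in> borel_measurable borel" "AE x in lborel. f x = f' x"
proof -
  have "(\<lambda>x. Re (f x)) \<in> borel_measurable lebesgue" "(\<lambda>x. Im (f x)) \<in> borel_measurable lebesgue"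
    by measurable
  from this[THEN completion_ex_borel_measurable_real] obtain r i
    where [measurable]: "r \<in> borel_measurable lborel" "i \<in> borel_measurable lborel"
      and ae: "AE x in lborel. Re (f x) = r x" "AE x in lborel. Im (f x) = i x"
    by blast
  show thesis
  proof
    show "(\<lambda>x. Complex (r x) (i x)) \<in> borel_measurable borel"
      unfolding Complex_eq by measurable
    show "AE x in lborel. f x = Complex (r x) (i x)"
      using ae by eventually_elim (simp add: complex_eq_iff)
  qed
qed

section \<open>Polar coordinates through the cone measure\<close>

lemma nn_integral_lborel_affine:
  fixes G :: "'a::euclidean_space \<Rightarrow> ennreal"
  assumes [measurable]: "G \<in> borel_measurable borel" and "c \<noteq> 0"
  shows "(\<integral>\<^sup>+x. G x \<partial>lborel) = ennreal (\<bar>c\<bar> ^ DIM('a)) * (\<integral>\<^sup>+x. G (t + c *\<^sub>R x) \<partial>lborel)"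
  using \<open>c \<noteq> 0\<close>
  by (subst lborel_affine[of c t]) (auto simp: nn_integral_density nn_integral_distr nn_integral_cmult)

lemma integrable_lborel_affine:
  fixes G :: "'a::euclidean_space \<Rightarrow> 'b::{banach, second_countable_topology}"
  assumes G: "integrable lborel G" and "c \<noteq> 0"
  shows "integrable lborel (\<lambda>x. G (t + c *\<^sub>R x))"
proof -
  have [measurable]: "G \<in> borel_measurable borel" using G by auto
  have "integrable (density (distr lborel borel (\<lambda>x. t + c *\<^sub>R x)) (\<lambda>_. \<bar>c\<bar> ^ DIM('a))) G"
    using G unfolding lborel_affine[OF \<open>c \<noteq> 0\<close>, of t, symmetric] .
  then have "integrable lborel (\<lambda>x. \<bar>c\<bar> ^ DIM('a) *\<^sub>R G (t + c *\<^sub>R x))"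
    by (simp add: integrable_density integrable_distr_eq)
  then have "integrable lborel (\<lambda>x. (1 / \<bar>c\<bar> ^ DIM('a)) *\<^sub>R (\<bar>c\<bar> ^ DIM('a) *\<^sub>R G (t + c *\<^sub>R x)))"
    by (rule integrable_scaleR_right)
  then show ?thesis using \<open>c \<noteq> 0\<close> by simp
qed

lemma integral_lborel_affine:
  fixes G :: "'a::euclidean_space \<Rightarrow> 'b::{banach, second_countable_topology}"
  assumes [measurable]: "G \<in> borel_measurable borel" and "c \<noteq> 0"
  shows "(LINT x|lborel. G x) = \<bar>c\<bar> ^ DIM('a) *\<^sub>R (LINT x|lborel. G (t + c *\<^sub>R x))"
  using \<open>c \<noteq> 0\<close>
  by (subst lborel_affine[of c t]) (auto simp: integral_density integral_distr)

lemma nn_integral_power_tail: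
  assumes "a > 0" "d > 0"
  shows "(\<integral>\<^sup>+t. ennreal (1 / t ^ (d + 1)) * indicator {a<..} t \<partial>lborel) = ennreal (1 / (real d * a ^ d))"
proof -
  have "(\<integral>\<^sup>+t. ennreal (1 / t ^ (d + 1)) * indicator {a<..} t \<partial>lborel)
      = (\<integral>\<^sup>+t. ennreal (1 / t ^ (d + 1)) * indicator {a..} t \<partial>lborel)"
    by (rule nn_integral_cong_AE, rule AE_mp[OF AE_lborel_singleton[of a]]) (auto simp: indicator_def)
  also have "\<dots> = ennreal (0 - (- 1 / (real d * a ^ d)))"
  proof (rule nn_integral_FTC_atLeast)
    show "(\<lambda>t::real. 1 / t ^ (d + 1)) \<in> borel_measurable borel" by measurable
    fix x :: real assume "a \<le> x"
    then have x: "x > 0" using assms by simp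
    show "0 \<le> 1 / x ^ (d + 1)" using x by simp
    have "((\<lambda>x. - 1 / real d * inverse (x ^ d)) has_real_derivative - 1 / real d * (- (inverse (x ^ d) * (real d * x ^ (d - Suc 0)) * inverse (x ^ d)))) (at x)"
      using x by (auto intro!: derivative_eq_intros)
    also have "- 1 / real d * (- (inverse (x ^ d) * (real d * x ^ (d - Suc 0)) * inverse (x ^ d))) = 1 / x ^ (d + 1)"
    proof -
      have "x ^ d = x * x ^ (d - Suc 0)" using assms(2) by (cases d) auto
      then show ?thesis using x assms(2) by (simp add: divide_simps)
    qed
    finally show "((\<lambda>x. - 1 / (real d * x ^ d)) has_real_derivative 1 / x ^ (d + 1)) (at x)"
      by (simp add: field_simps)
  next
    have "filterlim (\<lambda>x::real. real d * x ^ d) at_top at_top"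
      using assms(2) by (intro filterlim_tendsto_pos_mult_at_top[OF tendsto_const] filterlim_pow_at_top filterlim_ident) auto
    then show "((\<lambda>x::real. - 1 / (real d * x ^ d)) \<longlongrightarrow> 0) at_top"
      by (intro real_tendsto_divide_at_top[OF tendsto_const])
  qed
  finally show ?thesis by simp
qed

text \<open>
  Surface measure is the image of the volume of the unit ball, so the polar formula is an integral over pairs
  \<open>(s, w)\<close> of a radius and a point of the ball. For fixed \<open>w\<close> substitute \<open>s = norm w * t\<close>, which turns the argument of
  \<open>F\<close> into \<open>t *\<^sub>R w\<close>; for fixed \<open>t\<close> substitute \<open>v = t *\<^sub>R w\<close>; the remaining integral over \<open>t > norm v\<close> is elementary and
  its value cancels the power of \<open>norm v\<close> produced on the way.
\<close>

lemma nn_integral_polar: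
  fixes F :: "'a::euclidean_space \<Rightarrow> ennreal"
  assumes [measurable]: "F \<in> borel_measurable borel"
  shows "(\<integral>\<^sup>+s. \<integral>\<^sup>+w. ennreal (s ^ (DIM('a) - 1)) * indicator {0<..} s * indicator (ball 0 1) w * F ((s / norm w) *\<^sub>R w) \<partial>lborel \<partial>lborel)
    = ennreal (1 / real DIM('a)) * (\<integral>\<^sup>+x. F x \<partial>lborel)"
proof -
  let ?d = "DIM('a)"
  have d: "?d > 0" by simp
  have "(\<integral>\<^sup>+s. \<integral>\<^sup>+w. ennreal (s ^ (?d - 1)) * indicator {0<..} s * indicator (ball 0 1) w * F ((s / norm w) *\<^sub>R w) \<partial>lborel \<partial>lborel)
      = (\<integral>\<^sup>+w. \<integral>\<^sup>+s. ennreal (s ^ (?d - 1)) * indicator {0<..} s * indicator (ball 0 1) w * F ((s / norm w) *\<^sub>R w) \<partial>lborel \<partial>lborel)"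
    by (rule lborel_pair.Fubini') measurable
  also have "\<dots> = (\<integral>\<^sup>+w. \<integral>\<^sup>+t. ennreal (norm w ^ ?d * t ^ (?d - 1)) * indicator {0<..} t * indicator (ball 0 1) w * F (t *\<^sub>R w) \<partial>lborel \<partial>lborel)"
  proof (rule nn_integral_cong_AE, rule AE_mp[OF AE_lborel_singleton[of 0]], intro AE_I2 impI)
    fix w :: 'a assume "w \<noteq> 0"
    then have w: "norm w > 0" by simp
    have "(\<integral>\<^sup>+s. ennreal (s ^ (?d - 1)) * indicator {0<..} s * indicator (ball 0 1) w * F ((s / norm w) *\<^sub>R w) \<partial>lborel)
      = ennreal \<bar>norm w\<bar> * (\<integral>\<^sup>+t. ennreal ((0 + norm w * t) ^ (?d - 1)) * indicator {0<..} (0 + norm w * t) * indicator (ball 0 1) w * F (((0 + norm w * t) / norm w) *\<^sub>R w) \<partial>lborel)"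
      by (rule nn_integral_real_affine) (use w in auto)
    also have "\<dots> = (\<integral>\<^sup>+t. ennreal (norm w) * (ennreal ((norm w * t) ^ (?d - 1)) * indicator {0<..} (norm w * t) * indicator (ball 0 1) w * F (((norm w * t) / norm w) *\<^sub>R w)) \<partial>lborel)"
      by (simp add: nn_integral_cmult)
    also have "\<dots> = (\<integral>\<^sup>+t. ennreal (norm w ^ ?d * t ^ (?d - 1)) * indicator {0<..} t * indicator (ball 0 1) w * F (t *\<^sub>R w) \<partial>lborel)"
    proof (rule nn_integral_cong)
      fix t :: real
      show "ennreal (norm w) * (ennreal ((norm w * t) ^ (?d - 1)) * indicator {0<..} (norm w * t) * indicator (ball 0 1) w * F (((norm w * t) / norm w) *\<^sub>R w))
        = ennreal (norm w ^ ?d * t ^ (?d - 1)) * indicator {0<..} t * indicator (ball 0 1) w * F (t *\<^sub>R w)"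
      proof (cases "t > 0")
        case True
        have "ennreal (norm w ^ ?d * t ^ (?d - 1)) = ennreal (norm w) * ennreal ((norm w * t) ^ (?d - 1))"
          using w True d by (subst ennreal_mult[symmetric]) (auto simp: power_mult_distrib power_eq_if[of _ "?d"])
        then show ?thesis using w True by (simp add: mult.assoc)
      next
        case False
        then show ?thesis using w by (simp add: zero_less_mult_iff)
      qed
    qed
    finally show "(\<integral>\<^sup>+s. ennreal (s ^ (?d - 1)) * indicator {0<..} s * indicator (ball 0 1) w * F ((s / norm w) *\<^sub>R w) \<partial>lborel)
      = (\<integral>\<^sup>+t. ennreal (norm w ^ ?d * t ^ (?d - 1)) * indicator {0<..} t * indicator (ball 0 1) w * F (t *\<^sub>R w) \<partial>lborel)" .
  qed
  also have "\<dots> = (\<integral>\<^sup>+t. \<integral>\<^sup>+w. ennreal (norm w ^ ?d * t ^ (?d - 1)) * indicator {0<..} t * indicator (ball 0 1) w * F (t *\<^sub>R w) \<partial>lborel \<partial>lborel)"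
    by (rule lborel_pair.Fubini') measurable
  also have "\<dots> = (\<integral>\<^sup>+t. \<integral>\<^sup>+v. F v * ennreal (norm v ^ ?d) * (ennreal (1 / t ^ (?d + 1)) * indicator {norm v<..} t) \<partial>lborel \<partial>lborel)"
  proof (rule nn_integral_cong)
    fix t :: real
    show "(\<integral>\<^sup>+w. ennreal (norm w ^ ?d * t ^ (?d - 1)) * indicator {0<..} t * indicator (ball 0 1) w * F (t *\<^sub>R w) \<partial>lborel)
      = (\<integral>\<^sup>+v. F v * ennreal (norm v ^ ?d) * (ennreal (1 / t ^ (?d + 1)) * indicator {norm v<..} t) \<partial>lborel)"
    proof (cases "t > 0")
      case True
      have "(\<integral>\<^sup>+v. F v * ennreal (norm v ^ ?d) * (ennreal (1 / t ^ (?d + 1)) * indicator {norm v<..} t) \<partial>lborel)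
        = (\<integral>\<^sup>+v. ennreal (norm v ^ ?d / t ^ (?d + 1)) * indicator (ball 0 t) v * F v \<partial>lborel)"
      proof (rule nn_integral_cong)
        fix v :: 'a
        have "ennreal (norm v ^ ?d / t ^ (?d + 1)) = ennreal (norm v ^ ?d) * ennreal (1 / t ^ (?d + 1))"
          using True by (subst ennreal_mult[symmetric]) auto
        then show "F v * ennreal (norm v ^ ?d) * (ennreal (1 / t ^ (?d + 1)) * indicator {norm v<..} t) = ennreal (norm v ^ ?d / t ^ (?d + 1)) * indicator (ball 0 t) v * F v"
          by (auto simp: indicator_def mult_ac)
      qed
      also have "\<dots> = ennreal (t ^ ?d) * (\<integral>\<^sup>+w. ennreal (norm (t *\<^sub>R w) ^ ?d / t ^ (?d + 1)) * indicator (ball 0 t) (t *\<^sub>R w) * F (t *\<^sub>R w) \<partial>lborel)"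
        by (subst nn_integral_lborel_affine[where c = t and t = 0]) (use True in auto)
      also have "\<dots> = (\<integral>\<^sup>+w. ennreal (t ^ ?d) * (ennreal (norm (t *\<^sub>R w) ^ ?d / t ^ (?d + 1)) * indicator (ball 0 t) (t *\<^sub>R w) * F (t *\<^sub>R w)) \<partial>lborel)"
        by (simp add: nn_integral_cmult)
      also have "\<dots> = (\<integral>\<^sup>+w. ennreal (norm w ^ ?d * t ^ (?d - 1)) * indicator {0<..} t * indicator (ball 0 1) w * F (t *\<^sub>R w) \<partial>lborel)"
      proof (rule nn_integral_cong)
        fix w :: 'a
        have "t ^ (?d + 1) = t * t * t ^ (?d - 1)" "t ^ ?d = t * t ^ (?d - 1)"
          using d by (simp_all add: power_eq_if[of _ "?d"])
        then have "t ^ ?d * (norm (t *\<^sub>R w) ^ ?d / t ^ (?d + 1)) = norm w ^ ?d * t ^ (?d - 1)"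
          using True by (simp add: power_mult_distrib)
        then have "ennreal (norm w ^ ?d * t ^ (?d - 1)) = ennreal (t ^ ?d) * ennreal (norm (t *\<^sub>R w) ^ ?d / t ^ (?d + 1))"
          using True by (subst ennreal_mult[symmetric]) auto
        then show "ennreal (t ^ ?d) * (ennreal (norm (t *\<^sub>R w) ^ ?d / t ^ (?d + 1)) * indicator (ball 0 t) (t *\<^sub>R w) * F (t *\<^sub>R w))
          = ennreal (norm w ^ ?d * t ^ (?d - 1)) * indicator {0<..} t * indicator (ball 0 1) w * F (t *\<^sub>R w)"
          using True by (auto simp: indicator_def mult.assoc)
      qed
      finally show ?thesis by simp
    next
      case False
      then have "indicator {norm v<..} t = (0::ennreal)" for v :: 'a
        using norm_ge_zero[of v] by (auto simp: indicator_def simp del: norm_ge_zero)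
      then show ?thesis using False by simp
    qed
  qed
  also have "\<dots> = (\<integral>\<^sup>+v. \<integral>\<^sup>+t. F v * ennreal (norm v ^ ?d) * (ennreal (1 / t ^ (?d + 1)) * indicator {norm v<..} t) \<partial>lborel \<partial>lborel)"
    by (rule lborel_pair.Fubini') (unfold greaterThan_def indicator_def mem_Collect_eq, measurable)
  also have "\<dots> = (\<integral>\<^sup>+v. ennreal (1 / real ?d) * F v \<partial>lborel)"
  proof (rule nn_integral_cong_AE, rule AE_mp[OF AE_lborel_singleton[of 0]], intro AE_I2 impI)
    fix v :: 'a assume "v \<noteq> 0"
    then have v: "norm v > 0" by simp
    have "(\<integral>\<^sup>+t. F v * ennreal (norm v ^ ?d) * (ennreal (1 / t ^ (?d + 1)) * indicator {norm v<..} t) \<partial>lborel)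
      = F v * (ennreal (norm v ^ ?d) * ennreal (1 / (real ?d * norm v ^ ?d)))"
      using nn_integral_power_tail[OF v d] by (subst nn_integral_cmult) (auto simp: mult.assoc)
    also have "ennreal (norm v ^ ?d) * ennreal (1 / (real ?d * norm v ^ ?d)) = ennreal (1 / real ?d)"
      using v by (subst ennreal_mult[symmetric]) auto
    finally show "(\<integral>\<^sup>+t. F v * ennreal (norm v ^ ?d) * (ennreal (1 / t ^ (?d + 1)) * indicator {norm v<..} t) \<partial>lborel) = ennreal (1 / real ?d) * F v"
      by (simp add: mult.commute)
  qed
  also have "\<dots> = ennreal (1 / real ?d) * (\<integral>\<^sup>+x. F x \<partial>lborel)"
    by (rule nn_integral_cmult) simp
  finally show ?thesis .
qed

text \<open>
  For a function that is only Lebesgue measurable this is the reason why almost every spherical mean may be computed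
  from a Borel representative.
\<close>

lemma polar_null:
  fixes N :: "'a::euclidean_space set"
  assumes N: "N \<in> null_sets lborel"
  shows "AE s in lborel. s > 0 \<longrightarrow> (AE w in lborel. w \<in> ball 0 1 \<longrightarrow> (s / norm w) *\<^sub>R w \<notin> N)"
proof -
  have [measurable]: "N \<in> sets borel" using N by auto
  have "(\<integral>\<^sup>+s. \<integral>\<^sup>+w. ennreal (s ^ (DIM('a) - 1)) * indicator {0<..} s * indicator (ball 0 1) w * indicator N ((s / norm w) *\<^sub>R w) \<partial>lborel \<partial>lborel) = 0"
    using N by (subst nn_integral_polar) auto
  then have "AE s in lborel. (\<integral>\<^sup>+w. ennreal (s ^ (DIM('a) - 1)) * indicator {0<..} s * indicator (ball 0 1) w * indicator N ((s / norm w) *\<^sub>R w) \<partial>lborel) = 0"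
    by (subst (asm) nn_integral_0_iff_AE) measurable
  then show ?thesis
  proof eventually_elim
    case (elim s)
    then have *: "AE w in lborel. ennreal (s ^ (DIM('a) - 1)) * indicator {0<..} s * indicator (ball 0 1) w * indicator N ((s / norm w) *\<^sub>R w) = 0"
      by (subst (asm) nn_integral_0_iff_AE) measurable
    show ?case
    proof
      assume "s > 0"
      from * show "AE w in lborel. w \<in> ball 0 1 \<longrightarrow> (s / norm w) *\<^sub>R w \<notin> N"
        by eventually_elim (use \<open>s > 0\<close> in \<open>auto simp: indicator_def split: if_splits\<close>)
    qed
  qed
qed

text \<open>
  The polar formula, read for indicator functions, identifies an image measure with a multiple of Lebesgue measure. This transfers it
  to complex integrands.
\<close>

lemma polar_integral_zero:
  fixes F :: "'a::euclidean_space \<Rightarrow> complex"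
  assumes F: "integrable lborel F"
    and zero: "AE s in lborel. s > 0 \<longrightarrow> (LINT w|lborel. indicator (ball 0 1) w *\<^sub>R F ((s / norm w) *\<^sub>R w)) = 0"
  shows "(LINT x|lborel. F x) = 0"
proof -
  let ?d = "DIM('a)"
  define D where "D p = fst p ^ (?d - 1) * indicator {0<..} (fst p) * indicator (ball 0 1) (snd p)" for p :: "real \<times> 'a"
  define \<pi> where "\<pi> p = (fst p / norm (snd p)) *\<^sub>R snd p" for p :: "real \<times> 'a"
  let ?M = "lborel \<Otimes>\<^sub>M lborel :: (real \<times> 'a) measure"
  have [measurable]: "D \<in> borel_measurable ?M" "\<pi> \<in> ?M \<rightarrow>\<^sub>M borel"
    unfolding D_def \<pi>_def by measurable
  have Fm [measurable]: "F \<in> borel_measurable borel" using F by auto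
  have D0: "D p \<ge> 0" for p by (auto simp: D_def indicator_def)
  have eq: "distr (density ?M D) borel \<pi> = density lborel (\<lambda>_. ennreal (1 / real ?d))"
  proof (rule measure_eqI)
    fix A assume "A \<in> sets (distr (density ?M D) borel \<pi>)"
    then have [measurable]: "A \<in> sets borel" by simp
    have "emeasure (distr (density ?M D) borel \<pi>) A = (\<integral>\<^sup>+x. indicator A x \<partial>distr (density ?M D) borel \<pi>)"
      by simp
    also have "\<dots> = (\<integral>\<^sup>+p. indicator A (\<pi> p) \<partial>density ?M D)"
      by (rule nn_integral_distr) simp_all
    also have "\<dots> = (\<integral>\<^sup>+p. ennreal (D p) * indicator A (\<pi> p) \<partial>?M)"
      by (rule nn_integral_density) simp_all
    also have "\<dots> = (\<integral>\<^sup>+s. \<integral>\<^sup>+w. ennreal (D (s, w)) * indicator A (\<pi> (s, w)) \<partial>lborel \<partial>lborel)"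
      by (subst lborel.nn_integral_fst[symmetric]) simp_all
    also have "\<dots> = (\<integral>\<^sup>+s. \<integral>\<^sup>+w. ennreal (s ^ (?d - 1)) * indicator {0<..} s * indicator (ball 0 1) w * indicator A ((s / norm w) *\<^sub>R w) \<partial>lborel \<partial>lborel)"
      by (intro nn_integral_cong) (auto simp: D_def \<pi>_def indicator_def)
    also have "\<dots> = emeasure (density lborel (\<lambda>_. ennreal (1 / real ?d))) A"
      by (subst nn_integral_polar) (auto simp: emeasure_density nn_integral_cmult)
    finally show "emeasure (distr (density ?M D) borel \<pi>) A = emeasure (density lborel (\<lambda>_. ennreal (1 / real ?d))) A" .
  qed simp
  have "integrable (density lborel (\<lambda>_. ennreal (1 / real ?d))) F"
    using F by (subst integrable_density) auto
  then have "integrable (distr (density ?M D) borel \<pi>) F" by (simp add: eq)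
  then have int: "integrable ?M (\<lambda>p. D p *\<^sub>R F (\<pi> p))"
    using D0 by (subst (asm) integrable_distr_eq) (auto simp: integrable_density)
  have "(1 / real ?d) *\<^sub>R (LINT x|lborel. F x) = (LINT x|density lborel (\<lambda>_. ennreal (1 / real ?d)). F x)"
    by (subst integral_density) auto
  also have "\<dots> = (LINT p|?M. D p *\<^sub>R F (\<pi> p))"
    using D0 by (subst eq[symmetric]) (auto simp: integral_distr integral_density)
  also have "\<dots> = (LINT s|lborel. LINT w|lborel. D (s, w) *\<^sub>R F (\<pi> (s, w)))"
    by (rule lborel_pair.integral_fst'[symmetric]) (rule int)
  also have "\<dots> = 0"
  proof (rule integral_eq_zero_AE)
    show "AE s in lborel. (LINT w|lborel. D (s, w) *\<^sub>R F (\<pi> (s, w))) = 0"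
      using zero
    proof eventually_elim
      case (elim s)
      have "(LINT w|lborel. D (s, w) *\<^sub>R F (\<pi> (s, w))) =
        (LINT w|lborel. (s ^ (?d - 1) * indicator {0<..} s) *\<^sub>R (indicator (ball 0 1) w *\<^sub>R F ((s / norm w) *\<^sub>R w)))"
        by (simp add: D_def \<pi>_def)
      also have "\<dots> = (s ^ (?d - 1) * indicator {0<..} s) *\<^sub>R (LINT w|lborel. indicator (ball 0 1) w *\<^sub>R F ((s / norm w) *\<^sub>R w))"
        by (rule integral_scaleR_right)
      also have "\<dots> = 0" using elim by (auto simp: indicator_def)
      finally show ?case .
    qed
  qed
  finally show ?thesis by simp
qed

section \<open>Twisted Gaussian means\<close>

text \<open>
  The data of the problem in coordinate-free form, with \<open>f\<close> replaced by a Borel representative. The inequality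
  \<open>\<kappa> / 4 < c\<close> is the threshold in the growth condition.
\<close>

locale gaussian_decay =
  fixes J :: "'a::euclidean_space \<Rightarrow> 'a" and \<kappa> c :: real and f :: "'a \<Rightarrow> complex"
  assumes linear_J: "linear J"
    and skew: "x \<bullet> J y = - (J x \<bullet> y)"
    and norm_J: "norm (J x) = \<kappa> * norm x"
    and \<kappa>_pos: "\<kappa> > 0"
    and f_borel [measurable]: "f \<in> borel_measurable borel"
    and \<kappa>_less: "\<kappa> / 4 < c"
    and f_decay: "integrable lborel (\<lambda>w. norm (f w) * exp (c * (norm w)\<^sup>2))"
begin

definition kernel :: "real \<Rightarrow> 'a \<Rightarrow> 'a \<Rightarrow> complex" where
  "kernel b z w = f w * exp (- (\<i> / 2 * of_real (z \<bullet> J w)) - of_real (b * (norm (z - w))\<^sup>2))"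

definition gmean :: "real \<Rightarrow> 'a \<Rightarrow> complex" where
  "gmean b z = (LINT w|lborel. kernel b z w)"

lemma c_pos: "c > 0"
  using \<kappa>_pos \<kappa>_less by linarith

lemma continuous_J: "continuous_on S J"
  using linear_J by (simp add: linear_continuous_on linear_conv_bounded_linear)

lemma J_borel [measurable]: "J \<in> borel_measurable borel"
  using continuous_J by (rule borel_measurable_continuous_onI)

lemma inner_J_self [simp]: "x \<bullet> J x = 0" "J x \<bullet> x = 0"
  using skew[of x x] by (auto simp: inner_commute)

lemma J_diff: "J (x - y) = J x - J y"
  using linear_J by (rule linear_diff)

lemma kernel_borel [measurable]: "kernel b z \<in> borel_measurable borel"
  unfolding kernel_def by measurable

lemma norm_kernel: "norm (kernel b z w) = norm (f w) * exp (- b * (norm (z - w))\<^sup>2)"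
  by (simp add: kernel_def norm_mult)

lemma integrable_dominated:
  fixes g :: "'a \<Rightarrow> 'b::{banach, second_countable_topology}"
  assumes "g \<in> borel_measurable borel" and "A < c"
    and bound: "\<And>w. norm (g w) \<le> norm (f w) * exp (A * (norm w)\<^sup>2 + B * norm w + C)"
  shows "integrable lborel g"
proof -
  obtain K where K: "\<And>x. A * x\<^sup>2 + B * x + C \<le> c * x\<^sup>2 + K"
    using quadratic_absorb[OF \<open>A < c\<close>] by blast
  show ?thesis
  proof (rule Bochner_Integration.integrable_bound)
    show "integrable lborel (\<lambda>w. exp K * (norm (f w) * exp (c * (norm w)\<^sup>2)))"
      using f_decay by simp
    show "AE w in lborel. norm (g w) \<le> norm (exp K * (norm (f w) * exp (c * (norm w)\<^sup>2)))"
    proof (rule AE_I2)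
      fix w
      note bound[of w]
      also have "norm (f w) * exp (A * (norm w)\<^sup>2 + B * norm w + C) \<le> norm (f w) * exp (c * (norm w)\<^sup>2 + K)"
        using K by (intro mult_left_mono) auto
      also have "\<dots> = norm (exp K * (norm (f w) * exp (c * (norm w)\<^sup>2)))"
        by (simp add: exp_add)
      finally show "norm (g w) \<le> norm (exp K * (norm (f w) * exp (c * (norm w)\<^sup>2)))" .
    qed
  qed (use assms(1) in simp)
qed

lemma norm_kernel_le:
  assumes "- b \<le> a" "0 \<le> a" "norm z \<le> r"
  shows "norm (kernel b z w) \<le> norm (f w) * exp (a * (norm w)\<^sup>2 + 2 * a * r * norm w + a * r\<^sup>2)"
proof -
  have "- b * (norm (z - w))\<^sup>2 \<le> a * (norm (z - w))\<^sup>2"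
    using assms by (intro mult_right_mono) auto
  also have "\<dots> \<le> a * (norm w + r)\<^sup>2"
    using assms norm_triangle_ineq4[of z w] by (intro mult_left_mono power_mono) auto
  finally show ?thesis unfolding norm_kernel
    by (intro mult_left_mono) (auto simp: power2_sum algebra_simps)
qed

text \<open>
  These two bounds supply the majorants for exponential families: in the centre the exponent is affine in \<open>w\<close>, so every
  \<open>R\<close> is admissible, while in the time parameter it is quadratic and \<open>R\<close> is limited by the decay of \<open>f\<close>.
\<close>

lemma integrable_kernel_exp_linear:
  assumes "- b < c" "h \<in> borel_measurable borel" "\<And>w. norm (h w) \<le> L * (norm w + r)" "0 \<le> L" "0 \<le> r"
  shows "integrable lborel (\<lambda>w. norm (kernel b z w) * exp (R * norm (h w)))"
proof (rule integrable_dominated)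
  define a where "a = max 0 (- b)"
  show "a < c" using assms c_pos by (simp add: a_def)
  fix w
  have "R * norm (h w) \<le> \<bar>R\<bar> * (L * (norm w + r))"
    using assms(3)[of w] by (intro mult_mono) auto
  then have "norm (kernel b z w) * exp (R * norm (h w)) \<le>
      (norm (f w) * exp (a * (norm w)\<^sup>2 + 2 * a * norm z * norm w + a * (norm z)\<^sup>2)) * exp (\<bar>R\<bar> * (L * (norm w + r)))"
    by (intro mult_mono norm_kernel_le) (auto simp: a_def)
  also have "\<dots> = norm (f w) * exp (a * (norm w)\<^sup>2 + (2 * a * norm z + \<bar>R\<bar> * L) * norm w + (a * (norm z)\<^sup>2 + \<bar>R\<bar> * L * r))"
    by (simp add: mult.assoc algebra_simps flip: exp_add)
  finally show "norm (norm (kernel b z w) * exp (R * norm (h w))) \<le> norm (f w) * exp (a * (norm w)\<^sup>2 + (2 * a * norm z + \<bar>R\<bar> * L) * norm w + (a * (norm z)\<^sup>2 + \<bar>R\<bar> * L * r))"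
    by simp
qed (use assms(2) in measurable)

lemma integrable_kernel_exp_square:
  assumes "R - b < c"
  shows "integrable lborel (\<lambda>w. norm (kernel b z w) * exp (R * norm (complex_of_real ((norm (z - w))\<^sup>2))))"
proof (rule integrable_dominated)
  define a where "a = max 0 (R - b)"
  show "a < c" using assms c_pos by (simp add: a_def)
  fix w
  have "norm (kernel b z w) * exp (R * norm (complex_of_real ((norm (z - w))\<^sup>2))) = norm (kernel (b - R) z w)"
    by (simp add: norm_kernel mult.assoc algebra_simps norm_power flip: exp_add)
  also have "\<dots> \<le> norm (f w) * exp (a * (norm w)\<^sup>2 + 2 * a * norm z * norm w + a * (norm z)\<^sup>2)"
    by (rule norm_kernel_le) (auto simp: a_def)
  finally show "norm (norm (kernel b z w) * exp (R * norm (complex_of_real ((norm (z - w))\<^sup>2)))) \<le>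
     norm (f w) * exp (a * (norm w)\<^sup>2 + 2 * a * norm z * norm w + a * (norm z)\<^sup>2)" by simp
qed measurable

lemma kernel_time_shift: "kernel (b - t) z w = kernel b z w * exp (of_real t * of_real ((norm (z - w))\<^sup>2))"
  by (simp add: kernel_def mult.assoc algebra_simps flip: exp_add)

text \<open>
  Moving the centre from \<open>z\<close> to \<open>z + t *\<^sub>R v\<close> multiplies the kernel by \<open>e\<^bsup>t shift_exponent\<^esup>\<close>, up to a factor that
  does not involve \<open>w\<close>. That factor has been chosen to contain the phase \<open>e\<^bsup>-\<i> t (v \<bullet> J z)/2\<^esup>\<close>, which leaves
  \<open>J (z - w)\<close> rather than \<open>J w\<close> in the exponent: this is the gauge transformation that removes the magnetic potential
  at \<open>z\<close>.
\<close>

definition shift_exponent :: "real \<Rightarrow> 'a \<Rightarrow> 'a \<Rightarrow> 'a \<Rightarrow> complex" where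
  "shift_exponent b v z w = \<i> / 2 * of_real (v \<bullet> J (z - w)) - of_real (2 * b * (v \<bullet> (z - w)))"

lemma shift_exponent_borel [measurable]: "shift_exponent b v z \<in> borel_measurable borel"
  unfolding shift_exponent_def by measurable

lemma norm_shift_exponent_le: "norm (shift_exponent b v z w) \<le> ((\<kappa> / 2 + 2 * \<bar>b\<bar>) * norm v) * (norm w + norm z)"
proof -
  have "norm (shift_exponent b v z w) \<le> \<bar>v \<bullet> J (z - w)\<bar> / 2 + 2 * \<bar>b\<bar> * \<bar>v \<bullet> (z - w)\<bar>"
    unfolding shift_exponent_def by (rule norm_triangle_ineq4[THEN order_trans]) (simp add: norm_mult abs_mult)
  also have "\<dots> \<le> norm v * (\<kappa> * norm (z - w)) / 2 + 2 * \<bar>b\<bar> * (norm v * norm (z - w))"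
    using Cauchy_Schwarz_ineq2[of v "J (z - w)"] Cauchy_Schwarz_ineq2[of v "z - w"]
    by (intro add_mono divide_right_mono mult_left_mono) (auto simp: norm_J)
  also have "\<dots> = ((\<kappa> / 2 + 2 * \<bar>b\<bar>) * norm v) * norm (z - w)" by (simp add: algebra_simps)
  also have "\<dots> \<le> ((\<kappa> / 2 + 2 * \<bar>b\<bar>) * norm v) * (norm w + norm z)"
    using norm_triangle_ineq4[of z w] \<kappa>_pos by (intro mult_left_mono) auto
  finally show ?thesis .
qed

lemma integrable_kernel_shift_exponent:
  assumes "- b < c"
  shows "integrable lborel (\<lambda>w. norm (kernel b z w) * exp (R * norm (shift_exponent b v z w)))"
  using assms by (rule integrable_kernel_exp_linear) (use \<kappa>_pos norm_shift_exponent_le in auto)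

lemma kernel_space_shift:
  "kernel b (z + t *\<^sub>R v) w =
     exp (- of_real (b * t\<^sup>2 * (norm v)\<^sup>2) - \<i> / 2 * of_real (t * (v \<bullet> J z))) * (kernel b z w * exp (of_real t * shift_exponent b v z w))"
proof -
  have eq: "(norm (z + t *\<^sub>R v - w))\<^sup>2 = (norm (z - w))\<^sup>2 + 2 * t * (v \<bullet> (z - w)) + t\<^sup>2 * (norm v)\<^sup>2"
    unfolding power2_norm_eq_inner by (simp add: inner_simps inner_commute power2_eq_square algebra_simps)
  then show ?thesis
    unfolding kernel_def shift_exponent_def eq
    by (simp add: J_diff inner_simps mult.assoc algebra_simps flip: exp_add)
qed

lemma gmean_space_shift:
  "gmean b (z + t *\<^sub>R v) =
     exp (- of_real (b * t\<^sup>2 * (norm v)\<^sup>2) - \<i> / 2 * of_real (t * (v \<bullet> J z))) * (LINT w|lborel. kernel b z w * exp (of_real t * shift_exponent b v z w))"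
  unfolding gmean_def kernel_space_shift by simp

lemma gmean_time_shift:
  "gmean (b - t) z = (LINT w|lborel. kernel b z w * exp (of_real t * of_real ((norm (z - w))\<^sup>2)))"
  unfolding gmean_def kernel_time_shift by simp

lemma continuous_on_gmean: "continuous_on ({- \<kappa> / 4..} \<times> UNIV) (\<lambda>(b, z). gmean b z)"
  unfolding continuous_on_sequentially
proof safe
  fix u :: "nat \<Rightarrow> real \<times> 'a" and b z
  assume u: "u \<longlonglongrightarrow> (b, z)" and uin: "\<forall>n. u n \<in> {- \<kappa> / 4..} \<times> UNIV"
  have lim: "(\<lambda>n. fst (u n)) \<longlonglongrightarrow> b" "(\<lambda>n. snd (u n)) \<longlonglongrightarrow> z"
    using tendsto_fst[OF u] tendsto_snd[OF u] by auto
  obtain r where r: "\<And>n. norm (snd (u n)) \<le> r"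
    using convergent_imp_bounded[OF lim(2)] by (auto simp: bounded_iff)
  have b: "- fst (u n) \<le> \<kappa> / 4" for n using uin[rule_format, of n] by (auto simp: mem_Times_iff)
  have "(\<lambda>n. LINT w|lborel. kernel (fst (u n)) (snd (u n)) w) \<longlonglongrightarrow> (LINT w|lborel. kernel b z w)"
  proof (rule integral_dominated_convergence)
    show "integrable lborel (\<lambda>w. norm (f w) * exp (\<kappa> / 4 * (norm w)\<^sup>2 + 2 * (\<kappa> / 4) * r * norm w + \<kappa> / 4 * r\<^sup>2))"
      by (rule integrable_dominated[OF _ \<kappa>_less, where B = "2 * (\<kappa> / 4) * r" and C = "\<kappa> / 4 * r\<^sup>2"]) auto
    show "AE w in lborel. (\<lambda>n. kernel (fst (u n)) (snd (u n)) w) \<longlonglongrightarrow> kernel b z w"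
      unfolding kernel_def by (intro AE_I2 tendsto_intros lim)
    show "AE w in lborel. norm (kernel (fst (u n)) (snd (u n)) w) \<le> norm (f w) * exp (\<kappa> / 4 * (norm w)\<^sup>2 + 2 * (\<kappa> / 4) * r * norm w + \<kappa> / 4 * r\<^sup>2)" for n
      using \<kappa>_pos b r by (intro AE_I2 norm_kernel_le) auto
  qed auto
  then show "((\<lambda>(b, z). gmean b z) \<circ> u) \<longlonglongrightarrow> gmean b z"
    by (simp add: o_def gmean_def case_prod_unfold)
qed

text \<open>
  Continuation in time. The radius of convergence at \<open>b0 \<ge> 0\<close> is at least \<open>\<kappa> / 4\<close>, independently of \<open>b0\<close>, so finitely many
  steps of this length reach any \<open>b\<close>.
\<close>

lemma gmean_zero_later:
  assumes zero: "\<And>b. - \<kappa> / 4 < b \<Longrightarrow> b \<le> 0 \<Longrightarrow> gmean b z = 0" and "- \<kappa> / 4 < b"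
  shows "gmean b z = 0"
proof -
  have "\<forall>b. - \<kappa> / 4 < b \<and> b \<le> real k * (\<kappa> / 4) \<longrightarrow> gmean b z = 0" for k
  proof (induction k)
    case 0
    then show ?case using zero by auto
  next
    case (Suc k)
    define b0 where "b0 = real k * (\<kappa> / 4)"
    have b0: "b0 \<ge> 0" using \<kappa>_pos by (simp add: b0_def)
    show ?case
    proof (intro allI impI)
      fix b assume b: "- \<kappa> / 4 < b \<and> b \<le> real (Suc k) * (\<kappa> / 4)"
      show "gmean b z = 0"
      proof (cases "b \<le> b0")
        case True
        then show ?thesis using Suc b by (auto simp: b0_def)
      next
        case False
        have "(LINT w|lborel. kernel b0 z w * exp (of_real (b0 - b) * of_real ((norm (z - w))\<^sup>2))) = 0"
        proof (rule exp_family_continuation[where R = "\<kappa> / 4" and \<delta> = "\<kappa> / 4"])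
          show "integrable lborel (\<lambda>w. norm (kernel b0 z w) * exp (\<kappa> / 4 * norm (complex_of_real ((norm (z - w))\<^sup>2))))"
            by (rule integrable_kernel_exp_square) (use \<kappa>_less b0 in auto)
          show "(LINT w|lborel. kernel b0 z w * exp (of_real s * of_real ((norm (z - w))\<^sup>2))) = 0" if "0 < s" "s < \<kappa> / 4" for s
          proof -
            have "- \<kappa> / 4 < b0 - s" "b0 - s \<le> real k * (\<kappa> / 4)" using that b0 by linarith (use that in \<open>simp add: b0_def\<close>)
            then show ?thesis using Suc unfolding gmean_time_shift[symmetric] by blast
          qed
          show "norm (complex_of_real (b0 - b)) \<le> \<kappa> / 4"
            using False b unfolding norm_of_real by (auto simp: b0_def algebra_simps)
        qed (use \<kappa>_pos in auto)
        then show ?thesis using gmean_time_shift[of b0 "b0 - b" z] by simp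
      qed
    qed
  qed
  moreover obtain k where "b \<le> real k * (\<kappa> / 4)"
    using \<kappa>_pos real_arch_simple[of "b / (\<kappa> / 4)"] by (auto simp: field_simps)
  ultimately show ?thesis using assms(2) by blast
qed

text \<open>
  Continuation in space, along the line from \<open>z0\<close> to \<open>z\<close>: one step suffices because the family is entire in the
  line parameter.
\<close>

lemma gmean_zero_everywhere:
  assumes "open S" "z0 \<in> S" and zero: "\<And>z. z \<in> S \<Longrightarrow> gmean b z = 0" and b: "- b < c"
  shows "gmean b z = 0"
proof -
  define v where "v = z - z0"
  obtain e where e: "e > 0" "ball z0 e \<subseteq> S" using assms(1,2) by (auto simp: open_contains_ball)
  have "(LINT w|lborel. kernel b z0 w * exp (of_real 1 * shift_exponent b v z0 w)) = 0"
  proof (rule exp_family_continuation[where R = 1 and \<delta> = "e / (norm v + 1)"])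
    show "integrable lborel (\<lambda>w. norm (kernel b z0 w) * exp (1 * norm (shift_exponent b v z0 w)))"
      by (rule integrable_kernel_shift_exponent[OF b])
    show "0 < e / (norm v + 1)" using e by (simp add: add_nonneg_pos)
    show "(LINT w|lborel. kernel b z0 w * exp (of_real s * shift_exponent b v z0 w)) = 0" if s: "0 < s" "s < e / (norm v + 1)" for s
    proof -
      have "s * norm v \<le> s * (norm v + 1)" using s by (intro mult_left_mono) auto
      also have "\<dots> < e" using s by (simp add: pos_less_divide_eq add_nonneg_pos)
      finally have "z0 + s *\<^sub>R v \<in> S" using s e(2) by (auto simp: dist_norm)
      then show ?thesis using zero gmean_space_shift[of b z0 s v] by simp
    qed
  qed auto
  then show ?thesis using gmean_space_shift[of b z0 1 v] by (simp add: v_def)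
qed

end

section \<open>The parabolic maximum principle\<close>

context gaussian_decay
begin

text \<open>
  The computation of the magnetic Laplacian. The mixed terms add up to a multiple of \<open>J y \<bullet> y\<close>, which vanishes, and
  \<open>norm (J y) = \<kappa> * norm y\<close> makes the rest radial. The factor \<open>norm (z - w)\<^sup>2\<close> is also what differentiation in time
  brings down, and this coincidence is the heat equation.
\<close>

lemma sum_shift_exponent_square:
  "(\<Sum>e\<in>Basis. (shift_exponent b e z w)\<^sup>2) = of_real ((4 * b\<^sup>2 - \<kappa>\<^sup>2 / 4) * (norm (z - w))\<^sup>2)"
proof -
  define y where "y = z - w"
  have "(\<Sum>e\<in>Basis. (shift_exponent b e z w)\<^sup>2) =
     (\<Sum>e\<in>Basis. of_real (- (1/4) * ((J y \<bullet> e) * (J y \<bullet> e)) + 4 * b\<^sup>2 * ((y \<bullet> e) * (y \<bullet> e)))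
        - \<i> * of_real (2 * b) * of_real ((J y \<bullet> e) * (y \<bullet> e)))"
    by (intro sum.cong refl) (simp add: shift_exponent_def y_def power2_eq_square algebra_simps inner_commute)
  also have "\<dots> = of_real (- (1/4) * (J y \<bullet> J y) + 4 * b\<^sup>2 * (y \<bullet> y)) - \<i> * of_real (2 * b) * of_real (J y \<bullet> y)"
    unfolding euclidean_inner[of "J y" "J y"] euclidean_inner[of y y] euclidean_inner[of "J y" y]
    by (simp only: sum_subtractf sum.distrib of_real_sum of_real_add of_real_mult sum_distrib_left)
  also have "\<dots> = of_real ((4 * b\<^sup>2 - \<kappa>\<^sup>2 / 4) * (norm y)\<^sup>2)"
    using norm_J[of y] by (simp add: power_mult_distrib algebra_simps flip: power2_norm_eq_inner)
  finally show ?thesis by (simp add: y_def)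
qed

lemma Re_complex_of_real_mult: "Re (of_real x * y) = x * Re y"
  by simp

text \<open>
  A complex function whose modulus is maximal at \<open>z\<close> is rotated by the unit number \<open>u\<close> to be positive there; its real part
  then has a maximum at \<open>z\<close> and its second differences are nonpositive. The modulus ignores the gauge phase of the
  space shift, so only \<open>e\<^bsup>-b t\<^sup>2\<^esup>\<close> survives from the prefactor; it produces the right-hand side.
\<close>

lemma second_difference_test:
  assumes b: "- \<kappa> / 4 \<le> b" and e: "norm e = 1" and r: "r > 0"
    and max: "\<And>t. \<bar>t\<bar> < r \<Longrightarrow> norm (gmean b (z + t *\<^sub>R e)) \<le> norm (gmean b z)"
    and u: "norm u = 1" "u * gmean b z = of_real (norm (gmean b z))"
  shows "Re (u * (LINT w|lborel. kernel b z w * (shift_exponent b e z w)\<^sup>2)) \<le> 2 * b * norm (gmean b z)"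
proof -
  let ?P = "norm (gmean b z)"
  define I where "I s = (LINT w|lborel. kernel b z w * exp (s * shift_exponent b e z w))" for s
  define t where "t k = min (1/2) (r/2) / real (Suc k)" for k
  have t0: "t k > 0" for k using r by (simp add: t_def)
  have tle: "t k \<le> min (1/2) (r/2)" for k
    unfolding t_def by (rule divide_Suc_le) (use r in auto)
  have tr: "t k < r" "t k \<le> 1/2" for k using tle[of k] r by auto
  have tlim: "t \<longlonglongrightarrow> 0" unfolding t_def by (rule LIMSEQ_divide_Suc)
  have bc: "- b < c" using b \<kappa>_less by simp
  have D2: "(\<lambda>k. (I (of_real (t k)) + I (- of_real (t k)) - 2 * gmean b z) / of_real ((t k)\<^sup>2))
    \<longlonglongrightarrow> (LINT w|lborel. kernel b z w * (shift_exponent b e z w)\<^sup>2)"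
    unfolding I_def gmean_def
    by (rule exp_family_second_difference[where R = 1])
      (use integrable_kernel_shift_exponent[OF bc, of z 1 e] t0 tr(2) tlim in auto)
  have Ile: "Re (u * I (of_real s)) \<le> exp (b * s\<^sup>2) * ?P" if "\<bar>s\<bar> < r" for s
  proof -
    have "exp (- b * s\<^sup>2) * norm (I (of_real s)) = norm (gmean b (z + s *\<^sub>R e))"
      unfolding gmean_space_shift I_def by (simp add: norm_mult e)
    also have "\<dots> \<le> ?P" by (rule max[OF that])
    finally have "exp (b * s\<^sup>2) * (exp (- b * s\<^sup>2) * norm (I (of_real s))) \<le> exp (b * s\<^sup>2) * ?P"
      by (intro mult_left_mono) auto
    then have "norm (I (of_real s)) \<le> exp (b * s\<^sup>2) * ?P"
      by (simp add: mult.assoc[symmetric] flip: exp_add)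
    moreover have "Re (u * I (of_real s)) \<le> norm (I (of_real s))"
      using complex_Re_le_cmod[of "u * I (of_real s)"] u(1) by (simp add: norm_mult)
    ultimately show ?thesis by simp
  qed
  have "(\<lambda>k. Re (u * ((I (of_real (t k)) + I (- of_real (t k)) - 2 * gmean b z) / of_real ((t k)\<^sup>2))))
    \<longlonglongrightarrow> Re (u * (LINT w|lborel. kernel b z w * (shift_exponent b e z w)\<^sup>2))"
    by (intro tendsto_intros D2)
  moreover have "(\<lambda>k. 2 * ?P * ((exp (b * (t k)\<^sup>2) - 1) / (t k)\<^sup>2)) \<longlonglongrightarrow> 2 * ?P * b"
  proof (intro tendsto_mult tendsto_const)
    have "((\<lambda>s. exp (b * s)) has_field_derivative b) (at 0)" by (auto intro!: derivative_eq_intros)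
    then have "(\<lambda>s. (exp (b * s) - 1) / s) \<midarrow>0\<rightarrow> b" by (simp add: DERIV_def)
    moreover have "filterlim (\<lambda>k. (t k)\<^sup>2) (at 0) sequentially"
      unfolding filterlim_at using tendsto_power[OF tlim, of 2] t0 by (auto simp: less_imp_neq[symmetric])
    ultimately show "(\<lambda>k. (exp (b * (t k)\<^sup>2) - 1) / (t k)\<^sup>2) \<longlonglongrightarrow> b" by (rule filterlim_compose)
  qed
  moreover have "Re (u * ((I (of_real (t k)) + I (- of_real (t k)) - 2 * gmean b z) / of_real ((t k)\<^sup>2)))
      \<le> 2 * ?P * ((exp (b * (t k)\<^sup>2) - 1) / (t k)\<^sup>2)" for k
  proof -
    have "Re (u * I (of_real (t k))) + Re (u * I (of_real (- t k))) \<le> 2 * (exp (b * (t k)\<^sup>2) * ?P)"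
      using Ile[of "t k"] Ile[of "- t k"] tr(1)[of k] t0[of k] by simp
    moreover have "Re (u * gmean b z) = ?P" using u(2) by simp
    moreover have "u * ((I (of_real (t k)) + I (- of_real (t k)) - 2 * gmean b z) / of_real ((t k)\<^sup>2)) =
       (u * I (of_real (t k)) + u * I (of_real (- t k)) - 2 * (u * gmean b z)) / of_real ((t k)\<^sup>2)"
      by (simp add: algebra_simps)
    then have "Re (u * ((I (of_real (t k)) + I (- of_real (t k)) - 2 * gmean b z) / of_real ((t k)\<^sup>2)))
      = (Re (u * I (of_real (t k))) + Re (u * I (of_real (- t k))) - 2 * Re (u * gmean b z)) / (t k)\<^sup>2"
      by (simp only: Re_divide_of_real minus_complex.simps plus_complex.simps) simp
    ultimately have "Re (u * ((I (of_real (t k)) + I (- of_real (t k)) - 2 * gmean b z) / of_real ((t k)\<^sup>2)))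
      \<le> (2 * (exp (b * (t k)\<^sup>2) * ?P) - 2 * ?P) / (t k)\<^sup>2"
      by (simp only:) (intro divide_right_mono; simp)
    also have "\<dots> = 2 * ?P * ((exp (b * (t k)\<^sup>2) - 1) / (t k)\<^sup>2)" by (simp add: algebra_simps)
    finally show ?thesis .
  qed
  ultimately have "Re (u * (LINT w|lborel. kernel b z w * (shift_exponent b e z w)\<^sup>2)) \<le> 2 * ?P * b"
    by (intro LIMSEQ_le[where X = "\<lambda>k. Re (u * ((I (of_real (t k)) + I (- of_real (t k)) - 2 * gmean b z) / of_real ((t k)\<^sup>2)))"]) auto
  then show ?thesis by (simp add: mult_ac)
qed

text \<open>
  The same rotation in the time direction. Only earlier times are compared, so the conclusion is an inequality and
  holds at the final time too.
\<close>

lemma time_difference_test: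
  assumes b: "- \<kappa> / 4 < b"
    and m: "(m has_real_derivative m') (at b)" "m b > 0" "\<And>s. s > - \<kappa> / 4 \<Longrightarrow> m s > 0"
    and max: "\<And>s. - \<kappa> / 4 \<le> s \<Longrightarrow> s \<le> b \<Longrightarrow> m s * norm (gmean s z) \<le> m b * norm (gmean b z)"
    and u: "norm u = 1" "u * gmean b z = of_real (norm (gmean b z))"
  shows "Re (u * (LINT w|lborel. kernel b z w * of_real ((norm (z - w))\<^sup>2))) \<le> m' / m b * norm (gmean b z)"
proof -
  let ?P = "norm (gmean b z)"
  define R where "R = c - \<kappa> / 4"
  \<comment> \<open>Steps are short enough for the exponential majorant and do not go back beyond \<open>b = -\<kappa> / 4\<close>.\<close>
  define \<rho> where "\<rho> = min (R / 4) ((b + \<kappa> / 4) / 2)"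
  have R: "R > 0" using \<kappa>_less by (simp add: R_def)
  have \<rho>: "\<rho> > 0" using R b by (simp add: \<rho>_def)
  define t where "t k = \<rho> / real (Suc k)" for k
  have t0: "t k > 0" for k using \<rho> by (simp add: t_def)
  have tle: "t k \<le> \<rho>" for k
    unfolding t_def by (rule divide_Suc_le) (use \<rho> in auto)
  have tb: "- \<kappa> / 4 < b - t k" for k using tle[of k] b unfolding \<rho>_def by (auto simp: field_simps)
  have tR: "t k \<le> R / 2 / 2" for k using tle[of k] by (auto simp: \<rho>_def)
  have tlim: "t \<longlonglongrightarrow> 0" unfolding t_def by (rule LIMSEQ_divide_Suc)
  have "(\<lambda>k. (gmean (b - t k) z - gmean b z) / of_real (t k)) \<longlonglongrightarrow> (LINT w|lborel. kernel b z w * of_real ((norm (z - w))\<^sup>2))"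
    unfolding gmean_time_shift unfolding gmean_def
    by (rule exp_family_first_difference[where R = "R / 2"])
      (use integrable_kernel_exp_square[of "R / 2" b z] R b t0 tR tlim in \<open>auto simp: R_def field_simps\<close>)
  then have "(\<lambda>k. Re (u * ((gmean (b - t k) z - gmean b z) / of_real (t k)))) \<longlonglongrightarrow> Re (u * (LINT w|lborel. kernel b z w * of_real ((norm (z - w))\<^sup>2)))"
    by (intro tendsto_intros)
  moreover have "(\<lambda>k. ?P * ((m b / m (b - t k) - 1) / t k)) \<longlonglongrightarrow> ?P * (m' / m b)"
  proof (intro tendsto_mult tendsto_const)
    have "((\<lambda>s. m (b - s)) has_real_derivative m' * (- 1)) (at 0)"
      by (rule DERIV_chain2[of m _ "\<lambda>s. b - s"]) (use m(1) in \<open>auto intro!: derivative_eq_intros\<close>)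
    then have "((\<lambda>s. m b / m (b - s)) has_real_derivative m' / m b) (at 0)"
      using m(2) by (auto intro!: derivative_eq_intros simp: power2_eq_square)
    then have "(\<lambda>s. (m b / m (b - s) - 1) / s) \<midarrow>0\<rightarrow> m' / m b" using m(2) by (simp add: DERIV_def)
    moreover have "filterlim t (at 0) sequentially"
      unfolding filterlim_at using tlim t0 by (auto simp: less_imp_neq[symmetric])
    ultimately show "(\<lambda>k. (m b / m (b - t k) - 1) / t k) \<longlonglongrightarrow> m' / m b" by (rule filterlim_compose)
  qed
  moreover have "Re (u * ((gmean (b - t k) z - gmean b z) / of_real (t k))) \<le> ?P * ((m b / m (b - t k) - 1) / t k)" for k
  proof -
    have mk: "m (b - t k) > 0" using m(3) tb by blast
    have "m (b - t k) * norm (gmean (b - t k) z) \<le> m b * ?P"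
      using tb[of k] t0[of k] by (intro max) auto
    then have "norm (gmean (b - t k) z) \<le> m b / m (b - t k) * ?P"
      using mk by (simp add: field_simps)
    moreover have "Re (u * gmean (b - t k) z) \<le> norm (gmean (b - t k) z)"
      using complex_Re_le_cmod[of "u * gmean (b - t k) z"] u(1) by (simp add: norm_mult)
    moreover have "Re (u * gmean b z) = ?P" using u(2) by simp
    ultimately have "(Re (u * gmean (b - t k) z) - Re (u * gmean b z)) / t k \<le> (m b / m (b - t k) * ?P - ?P) / t k"
      using t0[of k] by (intro divide_right_mono) auto
    moreover have "Re (u * ((gmean (b - t k) z - gmean b z) / of_real (t k))) = (Re (u * gmean (b - t k) z) - Re (u * gmean b z)) / t k"
      by (metis (no_types, lifting) Re_divide_of_real minus_complex.simps(1) right_diff_distrib times_divide_eq_right)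
    ultimately show ?thesis by (simp add: algebra_simps)
  qed
  ultimately have "Re (u * (LINT w|lborel. kernel b z w * of_real ((norm (z - w))\<^sup>2))) \<le> ?P * (m' / m b)"
    by (intro LIMSEQ_le[where X = "\<lambda>k. Re (u * ((gmean (b - t k) z - gmean b z) / of_real (t k)))"]) auto
  then show ?thesis by (simp add: mult_ac)
qed

text \<open>
  The weight \<open>m\<close> replaces the prefactor \<open>(cosh s)\<^bsup>-d/2\<^esup>\<close>, written in the variable \<open>b\<close>. It must vanish at
  \<open>b = -\<beta>\<close>, that is at time \<open>-\<infinity>\<close>, so that the maximum over the compact set \<open>{-\<beta>..0} \<times> closure S\<close> is not taken there. It must
  also grow in time slightly more slowly than the prefactor, so that the two difference tests at a positive
  interior maximum contradict each other. The square root vanishes at the rate of \<open>(cosh s)\<^sup>-\<^sup>1\<close>, the prefactor in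
  dimension two, and the factor \<open>e\<^bsup>-b/\<beta>\<^esup>\<close> makes the inequality strict.
\<close>

proposition gmean_zero_inside:
  assumes d: "DIM('a) \<ge> 2" and "open S" "bounded S"
    and zero: "\<And>z b. z \<in> frontier S \<Longrightarrow> - \<kappa> / 4 \<le> b \<Longrightarrow> b \<le> 0 \<Longrightarrow> gmean b z = 0"
    and z: "z \<in> S" and b: "- \<kappa> / 4 < b" "b \<le> 0"
  shows "gmean b z = 0"
proof (rule ccontr)
  assume nz: "gmean b z \<noteq> 0"
  define \<beta> where "\<beta> = \<kappa> / 4"
  have \<beta>: "\<beta> > 0" using \<kappa>_pos by (simp add: \<beta>_def)
  define m where "m s = sqrt (\<beta> + s) * exp (- s / \<beta>)" for s
  let ?K = "{- \<beta>..0} \<times> closure S"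
  have mpos: "m s > 0" if "s > - \<beta>" for s using that by (simp add: m_def)
  have "continuous_on ?K (\<lambda>(s, x). gmean s x)"
    by (rule continuous_on_subset[OF continuous_on_gmean]) (auto simp: \<beta>_def)
  then have "continuous_on ?K (\<lambda>p. m (fst p) * norm (gmean (fst p) (snd p)))"
    unfolding m_def case_prod_unfold using \<beta> by (intro continuous_intros) auto
  moreover have "compact ?K" using \<open>bounded S\<close> by (intro compact_Times) auto
  moreover have "(b, z) \<in> ?K" using z b closure_subset by (auto simp: \<beta>_def)
  ultimately obtain p where p: "p \<in> ?K"
    and pmax: "\<And>q. q \<in> ?K \<Longrightarrow> m (fst q) * norm (gmean (fst q) (snd q)) \<le> m (fst p) * norm (gmean (fst p) (snd p))"
    using continuous_attains_sup[of ?K "\<lambda>p. m (fst p) * norm (gmean (fst p) (snd p))"] by blast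
  obtain b1 z1 where p_eq: "p = (b1, z1)" by (cases p)
  have max: "m s * norm (gmean s x) \<le> m b1 * norm (gmean b1 z1)" if "- \<beta> \<le> s" "s \<le> 0" "x \<in> closure S" for s x
    using pmax[of "(s, x)"] that by (simp add: p_eq)
  have in1: "- \<beta> \<le> b1" "b1 \<le> 0" "z1 \<in> closure S" using p by (auto simp: p_eq)
  have "0 < m b * norm (gmean b z)" using mpos b nz by (simp add: \<beta>_def)
  also have "\<dots> \<le> m b1 * norm (gmean b1 z1)" using b z closure_subset by (intro max) (auto simp: \<beta>_def)
  finally have pos: "0 < m b1 * norm (gmean b1 z1)" .
  define P where "P = norm (gmean b1 z1)"
  have P: "P > 0" using pos by (auto simp: P_def)
  have "b1 \<noteq> - \<beta>" using pos by (auto simp: m_def)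
  then have b1: "- \<beta> < b1" using in1 by simp
  have "z1 \<notin> frontier S" using zero[of z1 b1] in1 P by (auto simp: P_def \<beta>_def)
  then have "z1 \<in> S" using in1 \<open>open S\<close> by (auto simp: frontier_def interior_open)
  then obtain r where r: "r > 0" "ball z1 r \<subseteq> S" using \<open>open S\<close> by (auto simp: open_contains_ball)
  define u where "u = cnj (gmean b1 z1) / of_real P"
  have u: "norm u = 1" "u * gmean b1 z1 = of_real (norm (gmean b1 z1))"
    using P by (auto simp: u_def P_def norm_divide complex_norm_square[symmetric] power2_eq_square mult.commute)
  define Q where "Q = Re (u * (LINT w|lborel. kernel b1 z1 w * of_real ((norm (z1 - w))\<^sup>2)))"
  have time: "Q \<le> (1 / (2 * (\<beta> + b1)) - 1 / \<beta>) * P"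
  proof -
    have "(m has_real_derivative m b1 * (1 / (2 * (\<beta> + b1)) - 1 / \<beta>)) (at b1)"
    proof -
      define x where "x = sqrt (\<beta> + b1)"
      have x: "x > 0" "\<beta> + b1 = x * x" using b1 by (auto simp: x_def)
      have "(m has_real_derivative inverse x / 2 * exp (- b1 / \<beta>) + x * (exp (- b1 / \<beta>) * (- 1 / \<beta>))) (at b1)"
        unfolding m_def x_def using b1 \<beta> by (auto intro!: derivative_eq_intros)
      also have "inverse x / 2 * exp (- b1 / \<beta>) + x * (exp (- b1 / \<beta>) * (- 1 / \<beta>)) = m b1 * (1 / (2 * (\<beta> + b1)) - 1 / \<beta>)"
        unfolding m_def x_def[symmetric] x(2) using x(1) \<beta> by (simp add: field_simps)
      finally show ?thesis .
    qed
    then have "Q \<le> m b1 * (1 / (2 * (\<beta> + b1)) - 1 / \<beta>) / m b1 * P"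
      unfolding Q_def P_def
      by (rule time_difference_test[rotated]) (use b1 mpos u max in1 in \<open>auto simp: \<beta>_def\<close>)
    then show ?thesis using mpos[OF b1] by simp
  qed
  have space: "(4 * b1\<^sup>2 - 4 * \<beta>\<^sup>2) * Q \<le> real DIM('a) * (2 * b1 * P)"
  proof -
    have int: "integrable lborel (\<lambda>w. kernel b1 z1 w * (shift_exponent b1 e z1 w)\<^sup>2)" for e
      using integrable_exp_moment[of "kernel b1 z1" lborel "shift_exponent b1 e z1" 1 2] integrable_kernel_shift_exponent[of b1 z1 1 e] b1 \<kappa>_less
      by (simp add: \<beta>_def)
    have "(\<Sum>e\<in>Basis. Re (u * (LINT w|lborel. kernel b1 z1 w * (shift_exponent b1 e z1 w)\<^sup>2))) \<le> (\<Sum>e\<in>(Basis::'a set). 2 * b1 * P)"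
    proof (rule sum_mono)
      fix e :: 'a assume e: "e \<in> Basis"
      show "Re (u * (LINT w|lborel. kernel b1 z1 w * (shift_exponent b1 e z1 w)\<^sup>2)) \<le> 2 * b1 * P"
        unfolding P_def
      proof (rule second_difference_test[OF _ _ r(1) _ u])
        fix t assume t: "\<bar>t\<bar> < r"
        then have "z1 + t *\<^sub>R e \<in> closure S" using r(2) e closure_subset[of S] by (intro subsetD[OF order_trans[OF r(2) closure_subset]]) (auto simp: dist_norm)
        from max[OF in1(1,2) this] show "norm (gmean b1 (z1 + t *\<^sub>R e)) \<le> norm (gmean b1 z1)"
          using mpos[OF b1] by simp
      qed (use e b1 in \<open>auto simp: \<beta>_def\<close>)
    qed
    also have "(\<Sum>e\<in>Basis. Re (u * (LINT w|lborel. kernel b1 z1 w * (shift_exponent b1 e z1 w)\<^sup>2)))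
      = Re (u * (LINT w|lborel. (\<Sum>e\<in>Basis. kernel b1 z1 w * (shift_exponent b1 e z1 w)\<^sup>2)))"
      using int by (simp only: Bochner_Integration.integral_sum sum_distrib_left Re_sum)
    also have "(\<lambda>w. \<Sum>e\<in>Basis. kernel b1 z1 w * (shift_exponent b1 e z1 w)\<^sup>2)
       = (\<lambda>w. of_real (4 * b1\<^sup>2 - 4 * \<beta>\<^sup>2) * (kernel b1 z1 w * of_real ((norm (z1 - w))\<^sup>2)))"
      unfolding sum_distrib_left[symmetric] sum_shift_exponent_square by (simp add: \<beta>_def power_divide mult_ac)
    also have "Re (u * (LINT w|lborel. of_real (4 * b1\<^sup>2 - 4 * \<beta>\<^sup>2) * (kernel b1 z1 w * of_real ((norm (z1 - w))\<^sup>2)))) = (4 * b1\<^sup>2 - 4 * \<beta>\<^sup>2) * Q"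
      unfolding Q_def integral_mult_right_zero mult.left_commute[of u] Re_complex_of_real_mult ..
    finally show ?thesis by simp
  qed
  \<comment> \<open>The space test bounds \<open>Q\<close> from below and the time test from above; in dimension at least two the bounds cross.\<close>
  have "4 * (\<beta>\<^sup>2 - b1\<^sup>2) * Q \<le> 4 * (\<beta>\<^sup>2 - b1\<^sup>2) * ((1 / (2 * (\<beta> + b1)) - 1 / \<beta>) * P)"
    using time in1 b1 by (intro mult_left_mono) (auto simp: abs_le_square_iff[symmetric])
  also have "4 * (\<beta>\<^sup>2 - b1\<^sup>2) * ((1 / (2 * (\<beta> + b1)) - 1 / \<beta>) * P) = (2 * (\<beta> - b1) - 4 * (\<beta>\<^sup>2 - b1\<^sup>2) / \<beta>) * P"
    using b1 \<beta> by (simp add: divide_simps) (simp add: algebra_simps power2_eq_square)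
  finally have "- (real DIM('a) * (2 * b1 * P)) \<le> (2 * (\<beta> - b1) - 4 * (\<beta>\<^sup>2 - b1\<^sup>2) / \<beta>) * P"
    using space by (simp add: algebra_simps)
  then have "(- 2 * b1 * real DIM('a)) * P \<le> (2 * (\<beta> - b1) - 4 * (\<beta>\<^sup>2 - b1\<^sup>2) / \<beta>) * P"
    by (simp add: mult_ac)
  then have "- 2 * b1 * real DIM('a) \<le> 2 * (\<beta> - b1) - 4 * (\<beta>\<^sup>2 - b1\<^sup>2) / \<beta>"
    using P by (rule mult_right_le_imp_le)
  moreover have "- 2 * b1 * 2 \<le> - 2 * b1 * real DIM('a)" using d in1 by (intro mult_left_mono) auto
  ultimately have "4 * (\<beta>\<^sup>2 - b1\<^sup>2) / \<beta> \<le> 2 * (\<beta> + b1)" by simp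
  then have "(2 * (\<beta> - b1)) * (\<beta> + b1) \<le> \<beta> * (\<beta> + b1)" using \<beta> by (simp add: field_simps power2_eq_square)
  then have "2 * (\<beta> - b1) \<le> \<beta>" using b1 by (simp add: mult_le_cancel_right)
  then show False using \<beta> in1 by simp
qed

end

section \<open>From spherical means to Gaussian means\<close>

text \<open>
  A Borel function \<open>F1\<close> that agrees with \<open>F0\<close> outside a null set of the sphere yields the same integral: the sphere measure
  is complete, so \<open>F0\<close> is measurable for it.
\<close>

lemma sphere_measure_integral:
  fixes F0 F1 :: "'a::euclidean_space \<Rightarrow> complex"
  assumes F1 [measurable]: "F1 \<in> borel_measurable borel" and N: "N \<in> sets borel" "\<And>x. x \<notin> N \<Longrightarrow> F0 x = F1 x"
    and null: "AE w in lborel. w \<in> ball 0 1 \<longrightarrow> (s / norm w) *\<^sub>R w \<notin> N"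
  shows "(LINT w|sphere_measure s. F0 w) =
    (LINT w|lborel. indicator (ball 0 1) w *\<^sub>R F1 ((s / norm w) *\<^sub>R w)) /\<^sub>R measure lborel (ball (0::'a) 1)"
proof -
  let ?U = "uniform_measure lborel (ball (0::'a) 1)"
  let ?r = "\<lambda>w::'a. (s / norm w) *\<^sub>R w"
  let ?D = "distr ?U borel ?r"
  have [measurable]: "N \<in> sets borel" by fact
  have r [measurable]: "?r \<in> borel_measurable borel" by measurable
  have rU: "?r \<in> ?U \<rightarrow>\<^sub>M borel"
    by (subst measurable_cong_sets[OF sets_uniform_measure refl]) measurable
  have "AE w in ?U. ?r w \<notin> N"
    by (rule AE_uniform_measureI) (use null in auto)
  then have "AE x in ?D. x \<notin> N" using rU by (subst AE_distr_iff) auto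
  then have ae: "AE x in ?D. F1 x = F0 x" by eventually_elim (use N in auto)
  then have aec: "AE x in completion ?D. F1 x = F0 x" by (rule AE_completion)
  have F1c: "F1 \<in> borel_measurable (completion ?D)" by (intro measurable_completion) simp
  have F0c: "F0 \<in> borel_measurable (completion ?D)"
  proof (rule measurableI)
    fix A :: "complex set" assume A: "A \<in> sets borel"
    show "F0 -` A \<inter> space (completion ?D) \<in> sets (completion ?D)"
    proof (rule completion.in_sets_AE)
      show "F1 -` A \<inter> space (completion ?D) \<in> sets (completion ?D)" using F1c A by (rule measurable_sets)
      show "AE x in completion ?D. (x \<in> F1 -` A \<inter> space (completion ?D)) = (x \<in> F0 -` A \<inter> space (completion ?D))"
        using aec by eventually_elim auto
    qed auto
  qed simp
  have v: "measure lborel (ball (0::'a) 1) > 0"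
    by (simp add: content_ball)
  have ev: "emeasure lborel (ball (0::'a) 1) = ennreal (measure lborel (ball (0::'a) 1))"
    by (rule emeasure_eq_ennreal_measure) (use emeasure_lborel_ball_finite[of "0::'a" 1] in auto)
  have U: "?U = density lborel (\<lambda>x. ennreal (indicator (ball 0 1) x / measure lborel (ball (0::'a) 1)))"
    unfolding uniform_measure_def
    by (rule arg_cong[where f = "density lborel"]) (auto simp: ev indicator_def fun_eq_iff v divide_ennreal[OF _ v, of 1, simplified])
  have "(LINT w|sphere_measure s. F0 w) = (LINT w|completion ?D. F1 w)"
    unfolding sphere_measure_def using F0c F1c aec by (intro Bochner_Integration.integral_cong_AE) auto
  also have "\<dots> = (LINT w|?D. F1 w)" by (rule integral_completion) simp
  also have "\<dots> = (LINT w|?U. F1 (?r w))" by (rule integral_distr[OF rU]) simp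
  also have "\<dots> = (LINT w|lborel. (indicator (ball 0 1) w / measure lborel (ball (0::'a) 1)) *\<^sub>R F1 (?r w))"
    unfolding U by (rule integral_density) auto
  also have "\<dots> = (LINT w|lborel. (1 / measure lborel (ball (0::'a) 1)) *\<^sub>R (indicator (ball 0 1) w *\<^sub>R F1 (?r w)))"
    by simp
  also have "\<dots> = (1 / measure lborel (ball (0::'a) 1)) *\<^sub>R (LINT w|lborel. indicator (ball 0 1) w *\<^sub>R F1 (?r w))"
    by (rule integral_scaleR_right)
  finally show ?thesis by (simp add: divide_inverse)
qed

text \<open>
  A radial weight is constant on each sphere, so it does not affect the vanishing of the spherical integrals, and
  integration over the radius keeps them zero.
\<close>

lemma radial_integral_zero_of_sphere_means:
  fixes F0 F1 :: "'a::euclidean_space \<Rightarrow> complex" and \<phi> :: "real \<Rightarrow> complex"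
  assumes F1 [measurable]: "F1 \<in> borel_measurable borel" and ae: "AE x in lborel. F0 x = F1 x"
    and zero: "\<And>s. s > 0 \<Longrightarrow> (LINT w|sphere_measure s. F0 w) = 0"
    and int: "integrable lborel (\<lambda>w. \<phi> (norm w) * F1 w)"
  shows "(LINT w|lborel. \<phi> (norm w) * F1 w) = 0"
proof (rule polar_integral_zero[OF int])
  obtain N where N: "{x. F0 x \<noteq> F1 x} \<subseteq> N" "N \<in> null_sets lborel"
    using AE_E[OF ae] by (auto simp: null_sets_def)
  have v: "measure lborel (ball (0::'a) 1) > 0"
    by (simp add: content_ball)
  show "AE s in lborel. 0 < s \<longrightarrow> (LINT w|lborel. indicator (ball 0 1) w *\<^sub>R
      (\<phi> (norm ((s / norm w) *\<^sub>R w)) * F1 ((s / norm w) *\<^sub>R w))) = 0"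
    using polar_null[OF N(2)]
  proof eventually_elim
    case (elim s)
    show ?case
    proof
      assume s: "s > 0"
      have "(LINT w|lborel. indicator (ball 0 1) w *\<^sub>R F1 ((s / norm w) *\<^sub>R w)) /\<^sub>R measure lborel (ball (0::'a) 1) = (LINT w|sphere_measure s. F0 w)"
        by (rule sphere_measure_integral[symmetric, of F1 N]) (use N elim s in auto)
      then have *: "(LINT w|lborel. indicator (ball 0 1) w *\<^sub>R F1 ((s / norm w) *\<^sub>R w)) = 0"
        using zero[OF s] v by simp
      \<comment> \<open>The radial projection sends \<open>0\<close> to \<open>0\<close> instead of the sphere, hence the correction term at \<open>w = 0\<close>.\<close>
      have "(LINT w|lborel. indicator (ball 0 1) w *\<^sub>R (\<phi> (norm ((s / norm w) *\<^sub>R w)) * F1 ((s / norm w) *\<^sub>R w)))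
        = (LINT w|lborel. (if w = 0 then \<phi> 0 - \<phi> s else 0) * (indicator (ball 0 1) w *\<^sub>R F1 0) + \<phi> s * (indicator (ball 0 1) w *\<^sub>R F1 ((s / norm w) *\<^sub>R w)))"
        by (intro Bochner_Integration.integral_cong refl) (use s in \<open>auto simp: indicator_def algebra_simps\<close>)
      also have "\<dots> = (LINT w|lborel. \<phi> s * (indicator (ball 0 1) w *\<^sub>R F1 ((s / norm w) *\<^sub>R w)))"
      proof (rule Bochner_Integration.integral_cong_AE)
        show "AE w in lborel. (if w = 0 then \<phi> 0 - \<phi> s else 0) * (indicator (ball 0 1) w *\<^sub>R F1 0) + \<phi> s * (indicator (ball 0 1) w *\<^sub>R F1 ((s / norm w) *\<^sub>R w)) =
            \<phi> s * (indicator (ball 0 1) w *\<^sub>R F1 ((s / norm w) *\<^sub>R w))"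
          using AE_lborel_singleton[of "0::'a"] by eventually_elim simp
      qed measurable
      also have "\<dots> = 0" using * by (subst integral_mult_right_zero) simp
      finally show "(LINT w|lborel. indicator (ball 0 1) w *\<^sub>R (\<phi> (norm ((s / norm w) *\<^sub>R w)) * F1 ((s / norm w) *\<^sub>R w))) = 0" .
    qed
  qed
qed

lemma AE_lborel_reflect:
  fixes z :: "'a::euclidean_space"
  assumes "AE x in lborel. P x"
  shows "AE w in lborel. P (z - w)"
proof -
  obtain N where N: "{x. \<not> P x} \<subseteq> N" "N \<in> null_sets lborel"
    using AE_E[OF assms] by (auto simp: null_sets_def)
  have [measurable]: "N \<in> sets borel" using N by auto
  have "(\<integral>\<^sup>+w. indicator N (z + (- 1) *\<^sub>R w) \<partial>lborel) = 0"
    using nn_integral_lborel_affine[of "indicator N" "- 1" z] null_setsD1[OF N(2)] by simp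
  then have "AE w in lborel. indicator N (z + (- 1) *\<^sub>R w) = (0::ennreal)"
    by (subst (asm) nn_integral_0_iff_AE) auto
  then show ?thesis
    by eventually_elim (use N(1) in \<open>auto simp: indicator_def split: if_splits\<close>)
qed

context gaussian_decay
begin

lemma gmean_zero_of_sphere_means:
  assumes ae: "AE x in lborel. f0 x = f x" and b: "- b < c"
    and zero: "\<And>s. s > 0 \<Longrightarrow> (LINT w|sphere_measure s. f0 (z - w) * exp (\<i> / 2 * of_real (z \<bullet> J w))) = 0"
  shows "gmean b z = 0"
proof -
  define F where "F w = f (z - w) * exp (\<i> / 2 * of_real (z \<bullet> J w))" for w
  have [measurable]: "F \<in> borel_measurable borel" unfolding F_def by measurable
  have K: "kernel b z (z + (- 1) *\<^sub>R w) = exp (- of_real (b * (norm w)\<^sup>2)) * F w" for w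
    unfolding kernel_def F_def by (simp add: J_diff inner_simps mult_ac flip: exp_add)
  have "integrable lborel (kernel b z)"
    by (rule integrable_exp_family_0[of _ _ "shift_exponent b 0 z" 1])
       (use integrable_kernel_shift_exponent[OF b, of z 1 0] in auto)
  then have int: "integrable lborel (\<lambda>w. exp (- of_real (b * (norm w)\<^sup>2)) * F w)"
    unfolding K[symmetric]
    by (rule integrable_lborel_affine) simp
  have "(LINT w|lborel. exp (- of_real (b * (norm w)\<^sup>2)) * F w) = 0"
    by (rule radial_integral_zero_of_sphere_means[where \<phi> = "\<lambda>r. exp (- of_real (b * r\<^sup>2))", OF _ _ zero int])
      (use AE_lborel_reflect[OF ae, of z] in \<open>auto simp: F_def elim!: eventually_mono\<close>)
  then show ?thesis
    unfolding gmean_def by (subst integral_lborel_affine[of _ "- 1" z]) (simp_all only: kernel_borel K, simp_all)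
qed

end

section \<open>Recovering the function from its Gaussian means\<close>

text \<open>
  Boxes are closed under intersection and generate the Borel sets, and the sets over which \<open>f\<close> integrates to zero are
  closed under complements and disjoint unions.
\<close>

lemma AE_zero_of_box_integrals:
  fixes f :: "'a::euclidean_space \<Rightarrow> complex"
  assumes f: "integrable lborel f" and box: "\<And>l u. (LINT w:box l u|lborel. f w) = 0"
  shows "AE x in lborel. f x = 0"
proof (rule sigma_finite_measure.density_zero[OF lborel.sigma_finite_measure_axioms f])
  fix A :: "'a set" assume "A \<in> sets lborel"
  let ?E = "range (\<lambda>(a, b). box a b::'a set)"
  have si: "set_integrable lborel B f" if "B \<in> sets borel" for B
    unfolding set_integrable_def using f that by (intro integrable_mult_indicator) auto
  have sets: "sigma_sets UNIV ?E = sets (borel :: 'a measure)"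
    by (simp add: borel_eq_box)
  have whole: "(LINT w|lborel. f w) = 0"
  proof -
    let ?A = "\<lambda>n::nat. box (- (real n *\<^sub>R One)) (real n *\<^sub>R One) :: 'a set"
    have "(\<lambda>n. LINT w:?A n|lborel. f w) \<longlonglongrightarrow> (LINT w:(\<Union>n. ?A n)|lborel. f w)"
    proof (rule set_integral_cont_up)
      show "incseq ?A"
        by (auto simp: incseq_def box_def intro: order.strict_trans1 less_le_trans)
    qed (use si in auto)
    then have "(LINT w:(\<Union>n. ?A n)|lborel. f w) = 0" unfolding box by (simp add: LIMSEQ_const_iff)
    then show ?thesis unfolding UN_box_eq_UNIV by (simp add: set_lebesgue_integral_def)
  qed
  have "Int_stable ?E" "?E \<subseteq> Pow UNIV" by (auto simp: Int_stable_def box_Int_box)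
  moreover have "A \<in> sigma_sets UNIV ?E" using \<open>A \<in> sets lborel\<close> by (simp add: sets)
  ultimately show "(LINT w:A|lborel. f w) = 0"
  proof (induction rule: sigma_sets_induct_disjoint)
    case (basic A)
    then show ?case using box by auto
  next
    case empty
    then show ?case by (simp add: set_lebesgue_integral_def)
  next
    case (compl A)
    then have A: "A \<in> sets borel" by (simp add: sets)
    have "(LINT w|lborel. f w) = (LINT w:A \<union> (UNIV - A)|lborel. f w)"
      by (simp add: set_lebesgue_integral_def)
    also have "\<dots> = (LINT w:A|lborel. f w) + (LINT w:UNIV - A|lborel. f w)"
      using A by (intro set_integral_Un si) auto
    finally show ?case using compl whole by simp
  next
    case (union A)
    then have A: "A i \<in> sets borel" for i by (auto simp: sets)
    have "(LINT w:(\<Union>i. A i)|lborel. f w) = (\<Sum>i. LINT w:A i|lborel. f w)"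
      using A union(1) by (intro lebesgue_integral_countable_add si) (auto simp: disjoint_family_on_def)
    then show ?case using union by simp
  qed
qed

lemma indicator_shrinking_shift:
  fixes S :: "'a::euclidean_space set"
  assumes "w \<notin> frontier S" "d \<longlonglongrightarrow> 0"
  shows "(\<lambda>n. indicator S (w + d n) :: real) \<longlonglongrightarrow> indicator S w"
proof -
  have lim: "(\<lambda>n. w + d n) \<longlonglongrightarrow> w" using tendsto_add[OF tendsto_const assms(2), of w] by simp
  consider "w \<in> interior S" | "w \<in> - closure S" using assms(1) by (auto simp: frontier_def)
  then have "eventually (\<lambda>n. indicator S (w + d n) = (indicator S w :: real)) sequentially"
  proof cases
    case 1
    with topological_tendstoD[OF lim open_interior[of S]] show ?thesis
      by (auto elim!: eventually_mono simp: indicator_def dest: interior_subset[THEN subsetD])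
  next
    case 2
    with topological_tendstoD[OF lim open_Compl[OF closed_closure[of S]]] show ?thesis
      by (auto elim!: eventually_mono simp: indicator_def dest: closure_subset[THEN subsetD])
  qed
  then show ?thesis by (rule tendsto_eventually)
qed

lemma gaussian_integral_pos: "(LINT y|lborel. exp (- (norm (y::'a::euclidean_space))\<^sup>2)) > 0"
proof -
  have int: "integrable lborel (\<lambda>y::'a. exp (- (norm y)\<^sup>2))" using integrable_gaussian[of 1] by simp
  have "(LINT y|lborel. exp (- (norm (y::'a))\<^sup>2)) \<noteq> 0"
  proof
    assume "(LINT y|lborel. exp (- (norm (y::'a))\<^sup>2)) = 0"
    then have "AE y in lborel. exp (- (norm (y::'a))\<^sup>2) = 0"
      using integral_nonneg_eq_0_iff_AE[OF int] by simp
    then have "AE y in (lborel :: 'a measure). False" by eventually_elim simp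
    then show False by (simp add: AE_iff_measurable[OF _ refl])
  qed
  moreover have "(LINT y|lborel. exp (- (norm (y::'a))\<^sup>2)) \<ge> 0" by (intro integral_nonneg_AE) simp
  ultimately show ?thesis by linarith
qed

context gaussian_decay
begin

lemma integrable_f: "integrable lborel f"
  by (rule integrable_dominated[where A = 0 and B = 0 and C = 0]) (use c_pos in auto)

lemma box_integral_smoothed:
  assumes zero: "\<And>z. gmean b z = 0" and "b \<ge> 0" and B: "B \<in> sets borel" "emeasure lborel B < \<infinity>"
  shows "(LINT w|lborel. LINT z|lborel. indicator B z *\<^sub>R kernel b z w) = 0"
proof -
  have [measurable]: "B \<in> sets borel" by fact
  have kernel_pair [measurable]: "(\<lambda>(w, z). kernel b z w) \<in> borel_measurable (lborel \<Otimes>\<^sub>M lborel)"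
    unfolding kernel_def by measurable
  have "integrable (lborel \<Otimes>\<^sub>M lborel) (\<lambda>(w, z). indicator B z *\<^sub>R f w)"
  proof (rule lborel_pair.Fubini_integrable)
    have "(\<lambda>w. LINT z|lborel. norm (indicator B z *\<^sub>R f w)) = (\<lambda>w. measure lborel B * norm (f w))"
      by simp
    then show "integrable lborel (\<lambda>w. LINT z|lborel. norm (case (w, z) of (w, z) \<Rightarrow> indicator B z *\<^sub>R f w))"
      using integrable_f by simp
    show "AE w in lborel. integrable lborel (\<lambda>z. case (w, z) of (w, z) \<Rightarrow> indicator B z *\<^sub>R f w)"
      using B by (intro AE_I2) (auto intro!: integrable_scaleR_left)
  qed measurable
  then have "integrable (lborel \<Otimes>\<^sub>M lborel) (\<lambda>(w, z). indicator B z *\<^sub>R kernel b z w)"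
  proof (rule Bochner_Integration.integrable_bound)
    show "AE p in lborel \<Otimes>\<^sub>M lborel. norm (case p of (w, z) \<Rightarrow> indicator B z *\<^sub>R kernel b z w) \<le> norm (case p of (w, z) \<Rightarrow> indicator B z *\<^sub>R f w)"
      using \<open>b \<ge> 0\<close> by (intro AE_I2) (auto simp: norm_kernel indicator_def intro!: mult_left_le)
  qed measurable
  from lborel_pair.Fubini_integral[OF this, symmetric]
  have "(LINT w|lborel. LINT z|lborel. indicator B z *\<^sub>R kernel b z w) = (LINT z|lborel. LINT w|lborel. indicator B z *\<^sub>R kernel b z w)" .
  also have "\<dots> = (LINT z|lborel. indicator B z *\<^sub>R gmean b z)"
    unfolding gmean_def by (intro Bochner_Integration.integral_cong refl integral_scaleR_right)
  finally show ?thesis using zero by simp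
qed

lemma kernel_rescaled:
  assumes "r > 0" and [measurable]: "B \<in> sets borel"
  shows "(LINT z|lborel. indicator B z *\<^sub>R kernel (r\<^sup>2) z w) = (1 / r ^ DIM('a)) *\<^sub>R (f w *
    (LINT y|lborel. indicator B (w + (1 / r) *\<^sub>R y) *\<^sub>R (exp (- (\<i> / 2 * of_real ((1 / r) * (y \<bullet> J w)))) * of_real (exp (- (norm y)\<^sup>2)))))"
proof -
  have [measurable]: "(\<lambda>z. kernel (r\<^sup>2) z w) \<in> borel_measurable borel" unfolding kernel_def by measurable
  have K: "kernel (r\<^sup>2) (w + (1 / r) *\<^sub>R y) w = f w * (exp (- (\<i> / 2 * of_real ((1 / r) * (y \<bullet> J w)))) * of_real (exp (- (norm y)\<^sup>2)))" for y
  proof -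
    have "r\<^sup>2 * (norm ((1 / r) *\<^sub>R y))\<^sup>2 = (norm y)\<^sup>2"
      using assms by (simp add: power_divide)
    then show ?thesis
      by (simp add: kernel_def inner_simps exp_of_real[symmetric] norm_minus_commute exp_diff exp_minus field_simps)
  qed
  have "(LINT z|lborel. indicator B z *\<^sub>R kernel (r\<^sup>2) z w) =
    \<bar>1 / r\<bar> ^ DIM('a) *\<^sub>R (LINT y|lborel. indicator B (w + (1 / r) *\<^sub>R y) *\<^sub>R kernel (r\<^sup>2) (w + (1 / r) *\<^sub>R y) w)"
    by (rule integral_lborel_affine) (use assms in auto)
  also have "\<dots> = (1 / r ^ DIM('a)) *\<^sub>R (LINT y|lborel. f w * (indicator B (w + (1 / r) *\<^sub>R y) *\<^sub>R (exp (- (\<i> / 2 * of_real ((1 / r) * (y \<bullet> J w)))) * of_real (exp (- (norm y)\<^sup>2)))))"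
    unfolding K using assms by (simp add: power_divide)
  finally show ?thesis by (simp only: integral_mult_right_zero)
qed

text \<open>
  Integrating the Gaussian mean over a box \<open>B\<close> in \<open>z\<close> tests \<open>f\<close> against the indicator of \<open>B\<close> smoothed at scale
  \<open>1 / r\<close>. In the variable \<open>y = r *\<^sub>R (z - w)\<close> the phase becomes \<open>(1 / r) * (y \<bullet> J w)\<close>, because
  \<open>w \<bullet> J w = 0\<close>, so it disappears together with the smoothing as \<open>r\<close> grows. What remains is a
  positive multiple of the integral of \<open>f\<close> over \<open>B\<close>.
\<close>

proposition AE_zero_of_gmean_zero:
  assumes zero: "\<And>b z. b \<ge> 0 \<Longrightarrow> gmean b z = 0"
  shows "AE x in lborel. f x = 0"
proof (rule AE_zero_of_box_integrals[OF integrable_f])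
  fix l u :: 'a
  let ?B = "box l u"
  let ?I = "LINT y|lborel. exp (- (norm (y::'a))\<^sup>2)"
  have int: "integrable lborel (\<lambda>y::'a. exp (- (norm y)\<^sup>2))" using integrable_gaussian[of 1] by simp
  define r where "r n = real (Suc n)" for n
  define E where "E n w y = indicator ?B (w + (1 / r n) *\<^sub>R y) *\<^sub>R (exp (- (\<i> / 2 * of_real ((1 / r n) * (y \<bullet> J w)))) * of_real (exp (- (norm y)\<^sup>2)))" for n w y
  have [measurable]: "(\<lambda>(w, y). E n w y) \<in> borel_measurable (lborel \<Otimes>\<^sub>M lborel)" "E n w \<in> borel_measurable borel" for n w
    unfolding E_def by measurable
  have [measurable]: "(\<lambda>w. LINT y|lborel. E n w y) \<in> borel_measurable borel" for n
  proof -
    have "(\<lambda>w. LINT y|lborel. E n w y) \<in> borel_measurable lborel"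
      by (rule lborel.borel_measurable_lebesgue_integral) measurable
    then show ?thesis by simp
  qed
  have Ele: "norm (E n w y) \<le> exp (- (norm y)\<^sup>2)" for n w y
    by (auto simp: E_def norm_mult indicator_def)
  have r: "r n > 0" "(\<lambda>n. 1 / r n) \<longlonglongrightarrow> 0" for n
    unfolding r_def by (simp, rule LIMSEQ_divide_Suc)
  have "(LINT w|lborel. f w * (LINT y|lborel. E n w y)) = 0" for n
  proof -
    have "(LINT w|lborel. (1 / r n ^ DIM('a)) *\<^sub>R (f w * (LINT y|lborel. E n w y))) = (LINT w|lborel. LINT z|lborel. indicator ?B z *\<^sub>R kernel ((r n)\<^sup>2) z w)"
      unfolding E_def using r(1)[of n] by (subst kernel_rescaled) auto
    also have "\<dots> = 0"
      by (rule box_integral_smoothed) (use zero emeasure_lborel_box_finite in auto)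
    finally have "(1 / r n ^ DIM('a)) *\<^sub>R (LINT w|lborel. f w * (LINT y|lborel. E n w y)) = 0"
      by (simp only: integral_scaleR_right)
    then show ?thesis using r(1)[of n] by simp
  qed
  moreover have "(\<lambda>n. LINT w|lborel. f w * (LINT y|lborel. E n w y)) \<longlonglongrightarrow> (LINT w|lborel. f w * (indicator ?B w *\<^sub>R of_real ?I))"
  proof (rule integral_dominated_convergence)
    show "integrable lborel (\<lambda>w. norm (f w) * ?I)" using integrable_f by simp
    have "negligible (frontier ?B)" by (intro negligible_convex_frontier convex_box)
    then have "frontier ?B \<in> null_sets lborel"
      by (simp add: negligible_iff_null_sets null_sets_completion_iff)
    then have "AE w in lborel. w \<notin> frontier ?B" by (rule AE_not_in)
    then show "AE w in lborel. (\<lambda>n. f w * (LINT y|lborel. E n w y)) \<longlonglongrightarrow> f w * (indicator ?B w *\<^sub>R of_real ?I)"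
    proof eventually_elim
      case (elim w)
      have "(\<lambda>n. LINT y|lborel. E n w y) \<longlonglongrightarrow> (LINT y|lborel. indicator ?B w *\<^sub>R (exp (- (\<i> / 2 * of_real (0 * (y \<bullet> J w)))) * of_real (exp (- (norm y)\<^sup>2))))"
      proof (rule integral_dominated_convergence[OF _ _ int])
        show "AE y in lborel. (\<lambda>n. E n w y) \<longlonglongrightarrow> indicator ?B w *\<^sub>R (exp (- (\<i> / 2 * of_real (0 * (y \<bullet> J w)))) * of_real (exp (- (norm y)\<^sup>2)))"
        proof (rule AE_I2)
          fix y :: 'a
          have "(\<lambda>n. (1 / r n) *\<^sub>R y) \<longlonglongrightarrow> 0" using tendsto_scaleR[OF r(2) tendsto_const, of y] by simp
          then show "(\<lambda>n. E n w y) \<longlonglongrightarrow> indicator ?B w *\<^sub>R (exp (- (\<i> / 2 * of_real (0 * (y \<bullet> J w)))) * of_real (exp (- (norm y)\<^sup>2)))"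
            unfolding E_def by (intro tendsto_intros r(2) indicator_shrinking_shift elim)
        qed
      qed (use Ele in auto)
      also have "(LINT y|lborel. indicator ?B w *\<^sub>R (exp (- (\<i> / 2 * of_real (0 * (y \<bullet> J w)))) * of_real (exp (- (norm y)\<^sup>2)))) = indicator ?B w *\<^sub>R complex_of_real ?I"
        by simp
      finally show ?case by (intro tendsto_mult tendsto_const)
    qed
    show "AE w in lborel. norm (f w * (LINT y|lborel. E n w y)) \<le> norm (f w) * ?I" for n
    proof (rule AE_I2)
      fix w
      have "norm (LINT y|lborel. E n w y) \<le> ?I"
      proof (rule Bochner_Integration.integral_norm_bound_integral)
        show "integrable lborel (E n w)" by (rule Bochner_Integration.integrable_bound[OF int]) (use Ele in auto)
      qed (use Ele int in auto)
      then show "norm (f w * (LINT y|lborel. E n w y)) \<le> norm (f w) * ?I"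
        by (simp add: norm_mult mult_left_mono)
    qed
  qed auto
  ultimately have "(LINT w|lborel. f w * (indicator ?B w *\<^sub>R of_real ?I)) = 0"
    by (simp add: LIMSEQ_const_iff)
  also have "(\<lambda>w. f w * (indicator ?B w *\<^sub>R complex_of_real ?I)) = (\<lambda>w. of_real ?I * (indicator ?B w *\<^sub>R f w))"
    by (simp add: fun_eq_iff)
  finally have "of_real ?I * (LINT w|lborel. indicator ?B w *\<^sub>R f w) = 0"
    by (simp only: integral_mult_right_zero)
  then show "(LINT w:?B|lborel. f w) = 0"
    using gaussian_integral_pos[where 'a = 'a] by (simp add: set_lebesgue_integral_def)
qed

end

section \<open>The twist of an H-type group\<close>

lemma Re_cdot_cnj_vec: "Re (cdot z (cnj_vec v)) = z \<bullet> v"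
  by (simp add: cdot_def cnj_vec_def inner_vec_def inner_complex_def Re_sum)

lemma inner_realify: "realify z \<bullet> realify w = z \<bullet> w"
  by (simp add: inner_vec_def realify_def inner_complex_def UNIV_Plus_UNIV[symmetric] sum.Plus sum.distrib
      del: UNIV_Plus_UNIV)

lemma linear_realify: "linear realify"
  by (rule linearI) (auto simp: realify_def vec_eq_iff split: sum.split)

lemma linear_complexify: "linear complexify"
  by (rule linearI) (auto simp: complexify_def vec_eq_iff complex_eq_iff)

lemma inner_matrix_vector_transpose: "(A *v x) \<bullet> y = x \<bullet> (transpose A *v y)" for A :: "real ^ 'k::finite ^ 'l::finite"
  by (simp add: dot_lmul_matrix[symmetric] inner_commute)

lemma matrix_vector_mult_minus_left: "(- A) *v x = - (A *v x)" for A :: "real ^ 'k::finite ^ 'l::finite"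
  by (simp add: matrix_vector_mult_def vec_eq_iff sum_negf)

definition twist_map :: "('m::finite \<Rightarrow> real ^ ('n::finite + 'n) ^ ('n + 'n)) \<Rightarrow> real ^ 'm \<Rightarrow> complex ^ 'n \<Rightarrow> complex ^ 'n" where
  "twist_map U lam w = (\<Sum>j\<in>UNIV. lam $ j *\<^sub>R cact (U j) w)"

lemma realify_twist_map: "realify (twist_map U lam w) = (\<Sum>j\<in>UNIV. lam $ j *\<^sub>R (U j *v realify w))"
  unfolding twist_map_def cact_def
  by (simp add: linear_sum[OF linear_realify] linear_scale[OF linear_realify] realify_complexify)

lemma linear_twist_map: "linear (twist_map U lam)"
proof -
  have "linear (\<lambda>w. lam $ j *\<^sub>R cact (U j) w)" for j
    unfolding cact_def
    by (rule linear_compose_scale_right)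
       (rule linear_compose[OF linear_realify linear_compose[OF matrix_vector_mul_linear linear_complexify], unfolded o_def])
  then show ?thesis unfolding twist_map_def[abs_def] by (intro linear_compose_sum) auto
qed

lemma twist_phase:
  "(\<Sum>j\<in>UNIV. lam $ j * Re (cdot z (cnj_vec (cact (U j) w)))) = z \<bullet> twist_map U lam w"
  by (simp add: Re_cdot_cnj_vec twist_map_def inner_sum_right)

lemma skew_twist_map:
  assumes "h_type_matrices U"
  shows "z \<bullet> twist_map U lam w = - (twist_map U lam z \<bullet> w)"
proof -
  have "realify z \<bullet> (U j *v realify w) = - ((U j *v realify z) \<bullet> realify w)" for j
  proof -
    have "transpose (U j) = - U j" using assms by (simp add: h_type_matrices_def)
    then show ?thesis unfolding inner_matrix_vector_transpose by (simp only: matrix_vector_mult_minus_left inner_minus_right minus_minus)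
  qed
  then show ?thesis
    by (simp add: realify_twist_map inner_sum_left inner_sum_right sum_negf flip: inner_realify)
qed

text \<open>
  The squared norm is a quadratic form in \<open>lam\<close> with coefficients \<open>(U j *v x) \<bullet> (U l *v x)\<close>. Skewness turns the
  anticommutation relation into orthogonality of \<open>U j *v x\<close> and \<open>U l *v x\<close> for \<open>j \<noteq> l\<close>, so only the diagonal survives.
\<close>

lemma norm_twist_map:
  assumes U: "h_type_matrices U"
  shows "norm (twist_map U lam w) = norm lam * norm w"
proof -
  define x where "x = realify w"
  have prod: "(U j *v x) \<bullet> (U l *v x) = - (x \<bullet> ((U j ** U l) *v x))" for j l
  proof -
    have "transpose (U j) = - U j" using U by (simp add: h_type_matrices_def)
    then show ?thesis unfolding inner_matrix_vector_transpose
      by (simp only: matrix_vector_mult_minus_left inner_minus_right matrix_vector_mul_assoc[symmetric])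
  qed
  have off: "(U j *v x) \<bullet> (U l *v x) = 0" if "j \<noteq> l" for j l
  proof -
    have "2 * ((U j *v x) \<bullet> (U l *v x)) = (U j *v x) \<bullet> (U l *v x) + (U l *v x) \<bullet> (U j *v x)"
      by (simp add: inner_commute)
    also have "\<dots> = - (x \<bullet> ((U j ** U l + U l ** U j) *v x))"
      unfolding prod by (simp add: matrix_vector_mult_add_rdistrib inner_add_right)
    also have "\<dots> = 0" using U that by (simp add: h_type_matrices_def)
    finally show ?thesis by simp
  qed
  have diag: "(U j *v x) \<bullet> (U j *v x) = x \<bullet> x" for j
  proof -
    have "transpose (U j) ** U j = mat 1" using U unfolding h_type_matrices_def orthogonal_matrix_def by blast
    then show ?thesis unfolding inner_matrix_vector_transpose by (simp only: matrix_vector_mul_assoc matrix_vector_mul_lid)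
  qed
  have "(norm (twist_map U lam w))\<^sup>2 = (\<Sum>j\<in>UNIV. \<Sum>l\<in>UNIV. lam $ j * lam $ l * ((U j *v x) \<bullet> (U l *v x)))"
    unfolding power2_norm_eq_inner inner_realify[symmetric] realify_twist_map x_def[symmetric]
    by (simp add: inner_sum_left inner_sum_right sum_distrib_left mult_ac inner_commute)
  also have "\<dots> = (\<Sum>j\<in>UNIV. \<Sum>l\<in>UNIV. if l = j then lam $ j * lam $ j * (x \<bullet> x) else 0)"
    by (intro sum.cong refl) (auto simp: off diag)
  also have "\<dots> = (norm lam)\<^sup>2 * (norm w)\<^sup>2"
    by (simp add: power2_norm_eq_inner inner_vec_def[of lam] sum_distrib_right x_def inner_realify)
  finally have "(norm (twist_map U lam w))\<^sup>2 = (norm lam * norm w)\<^sup>2" by (simp only: power_mult_distrib)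
  then show ?thesis by (rule power2_eq_imp_eq) auto
qed

theorem theorem4p7:
  fixes G :: "((real ^ ('n::finite + 'n)) \<times> (real ^ 'm::finite)) monoid"
    and U :: "'m \<Rightarrow> real ^ ('n + 'n) ^ ('n + 'n)"
    and lam :: "real ^ 'm"
    and \<Omega> :: "(complex ^ 'n) set"
    and f :: "complex ^ 'n \<Rightarrow> complex"
    and \<epsilon> :: real
    and p :: ennreal
  assumes "is_h_type_group G U"
    and "lam \<noteq> 0"
    and "open \<Omega>" "connected \<Omega>" "\<Omega> \<noteq> {}" "bounded \<Omega>"
    and "\<epsilon> > 0"
    and "1 \<le> p"
    and "in_Lp p (\<lambda>z. f z * of_real (exp ((1/4 + \<epsilon>) * norm lam * (norm z)\<^sup>2)))"
    and "\<And>z s. z \<in> frontier \<Omega> \<Longrightarrow> s > 0 \<Longrightarrow> twisted_spherical_mean U lam f s z = 0"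
  shows "AE z in lebesgue. f z = 0"
proof -
  have U: "h_type_matrices U" using assms(1) by (simp add: is_h_type_group_def)
  define \<kappa> where "\<kappa> = norm lam"
  define c where "c = (1/4 + \<epsilon> / 2) * \<kappa>"
  have \<kappa>: "\<kappa> > 0" using assms(2) by (simp add: \<kappa>_def)
  have c: "\<kappa> / 4 < c" "c < (1/4 + \<epsilon>) * \<kappa>"
    using \<kappa> \<open>\<epsilon> > 0\<close> by (auto simp: c_def field_simps)
  have Lp: "in_Lp p (\<lambda>z. f z * of_real (exp (((1/4 + \<epsilon>) * \<kappa>) * (norm z)\<^sup>2)))"
    using assms(9) by (simp add: \<kappa>_def)
  obtain g where g [measurable]: "g \<in> borel_measurable borel" and fg: "AE z in lborel. f z = g z"
    using lebesgue_measurable_borel_representative[OF measurable_of_in_Lp_weighted[OF Lp]] .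
  have fgc: "AE z in lebesgue. f z = g z" using fg by (rule AE_completion)
  have "integrable lebesgue (\<lambda>z. norm (f z) * exp (c * (norm z)\<^sup>2))"
    by (rule integrable_of_in_Lp_weighted[OF Lp assms(8) c(2)])
  moreover have "(\<lambda>z. norm (g z) * exp (c * (norm z)\<^sup>2)) \<in> borel_measurable lebesgue"
    by (intro measurable_completion) simp
  moreover have "AE z in lebesgue. norm (f z) * exp (c * (norm z)\<^sup>2) = norm (g z) * exp (c * (norm z)\<^sup>2)"
    using fgc by eventually_elim simp
  ultimately have "integrable lebesgue (\<lambda>z. norm (g z) * exp (c * (norm z)\<^sup>2))"
    by (rule integrable_cong_AE_imp)
  then have decay: "integrable lborel (\<lambda>z. norm (g z) * exp (c * (norm z)\<^sup>2))"
    by (subst (asm) integrable_completion) auto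
  interpret gaussian_decay "twist_map U lam" \<kappa> c g
    by (rule gaussian_decay.intro)
      (use c \<kappa> linear_twist_map skew_twist_map[OF U] norm_twist_map[OF U] decay in \<open>auto simp: \<kappa>_def\<close>)
  have boundary: "gmean b z = 0" if "z \<in> frontier \<Omega>" "- \<kappa> / 4 \<le> b" for b z
  proof (rule gmean_zero_of_sphere_means[OF fg])
    show "- b < c" using that(2) c(1) by simp
    show "(LINT w|sphere_measure s. f (z - w) * exp (\<i> / 2 * of_real (z \<bullet> twist_map U lam w))) = 0" if "s > 0" for s
      using assms(10)[OF \<open>z \<in> frontier \<Omega>\<close> that] by (simp add: twisted_spherical_mean_def twist_phase)
  qed
  have "DIM(complex ^ 'n) = 2 * CARD('n)" by simp
  then have dim: "DIM(complex ^ 'n) \<ge> 2" using zero_less_card_finite[where 'a = 'n] by linarith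
  have inside: "gmean b z = 0" if "z \<in> \<Omega>" "- \<kappa> / 4 < b" "b \<le> 0" for b z
    by (rule gmean_zero_inside[OF dim \<open>open \<Omega>\<close> \<open>bounded \<Omega>\<close> boundary]) (use that in auto)
  obtain z0 where "z0 \<in> \<Omega>" using \<open>\<Omega> \<noteq> {}\<close> by blast
  have later: "gmean b z = 0" if "z \<in> \<Omega>" "b \<ge> 0" for b z
    by (rule gmean_zero_later) (use that inside[of z] \<kappa> in auto)
  have "gmean b z = 0" if "b \<ge> 0" for b z
    by (rule gmean_zero_everywhere[OF \<open>open \<Omega>\<close> \<open>z0 \<in> \<Omega>\<close> later]) (use that c_pos in auto)
  then have "AE z in lborel. g z = 0" by (rule AE_zero_of_gmean_zero)
  then have "AE z in lebesgue. g z = 0" by (rule AE_completion)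
  with fgc show ?thesis by eventually_elim simp
qed

end
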